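(* Let $(M,g)$ be a real analytic Riemannian manifold of dimension $n\ge2$, let $f:M\to\mathbb R$ be a real analytic function attaining its maximum $f_{\max}$, with $\mathrm{MAX}(f)=\{x\in M:f(x)=f_{\max}\}$ disjoint from $\partial M$ (if $M$ has boundary), and let $\Sigma\neq\emptyset$ be the top stratum of $\mathrm{MAX}(f)$. If $\nabla^2f$ is nowhere vanishing on $\overline\Sigma$, then $$\overline\Sigma=\Sigma,$$ thus $\Sigma$ is a complete real analytic hypersurface with empty boundary.
   Context: **Top stratum.** By Łojasiewicz's structure theorem $\mathrm{MAX}(f)$ decomposes into real analytic submanifolds of dimensions $0,\dots,n-1$; the top stratum is the $(n-1)$-dimensional part: the set of points $p\in\mathrm{MAX}(f)$ having an open neighborhood $\Omega$ such that $\Omega\cap\mathrm{MAX}(f)$ is an embedded real analytic hypersurface of $\Omega$. $\overline\Sigma$ is the closure of $\Sigma$ in $M$, and $\nabla^2f$ is the Hessian of $f$ with respect to $g$.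
   Formalization: "Complete" is stated as: Σ is closed in M, and Σ is complete in its induced distance whenever (M,g) is complete; without completeness of M the metric claim fails (open unit disc, f = -x²). *)

theory Defs
  imports "HOL-Analysis.Analysis"
begin

section \<open>Real analytic maps\<close>

text \<open>Multi-indices are extensional functions from the standard basis to the naturals;
  convergence of the power series is unconditional.\<close>

definition real_analytic_at :: "('a::euclidean_space \<Rightarrow> 'b::euclidean_space) \<Rightarrow> 'a \<Rightarrow> bool" where
  "real_analytic_at f a \<longleftrightarrow>
     (\<exists>C r. 0 < r \<and> (\<forall>x\<in>ball a r.
        ((\<lambda>\<alpha>. (\<Prod>i\<in>Basis. ((x - a) \<bullet> i) ^ \<alpha> i) *\<^sub>R C \<alpha>) has_sum f x) (Basis \<rightarrow>\<^sub>E (UNIV :: nat set))))"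

text \<open>On a set that need not be open (e.g. a relatively open subset of a half-space), analyticity
  means that the map extends analytically near every point of the set.\<close>

definition real_analytic_on :: "'a::euclidean_space set \<Rightarrow> ('a \<Rightarrow> 'b::euclidean_space) \<Rightarrow> bool" where
  "real_analytic_on V f \<longleftrightarrow>
     (\<forall>a\<in>V. \<exists>F. real_analytic_at F a \<and> (\<exists>r>0. \<forall>x\<in>V \<inter> ball a r. f x = F x))"

text \<open>Directional derivative at \<^term>\<open>x\<close> in direction \<^term>\<open>u\<close>, taken within \<^term>\<open>V\<close>. It is only
  used where \<^term>\<open>V\<close> is relatively open in the whole space or in a half-space, where the Frechet
  derivative within \<^term>\<open>V\<close> is unique.\<close>

definition dir_deriv ::
    "'a::euclidean_space set \<Rightarrow> ('a \<Rightarrow> 'b::euclidean_space) \<Rightarrow> 'a \<Rightarrow> 'a \<Rightarrow> 'b" where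
  "dir_deriv V F x u = frechet_derivative F (at x within V) u"


section \<open>Real analytic manifolds, possibly with boundary\<close>

text \<open>The manifold is the whole type \<^typ>\<open>'m\<close>, which the main result takes to be Hausdorff and second
  countable; its dimension is that of the model space \<^typ>\<open>'e\<close>.\<close>

type_synonym ('m, 'e) chart = "'m set \<times> ('m \<Rightarrow> 'e)"

abbreviation cdom :: "('m, 'e) chart \<Rightarrow> 'm set" where "cdom c \<equiv> fst c"
abbreviation cmap :: "('m, 'e) chart \<Rightarrow> 'm \<Rightarrow> 'e" where "cmap c \<equiv> snd c"
abbreviation cimage :: "('m, 'e) chart \<Rightarrow> 'e set" where "cimage c \<equiv> cmap c ` cdom c"

definition in_chart :: "('m, 'e) chart \<Rightarrow> ('m \<Rightarrow> 'b) \<Rightarrow> 'e \<Rightarrow> 'b" where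
  "in_chart c f = f \<circ> inv_into (cdom c) (cmap c)"

abbreviation transition :: "('m, 'e) chart \<Rightarrow> ('m, 'e) chart \<Rightarrow> 'e \<Rightarrow> 'e" where
  "transition c d \<equiv> in_chart c (cmap d)"

text \<open>Charts take values in the model space or in a closed coordinate half-space.\<close>

definition is_chart :: "('m::topological_space, 'e::euclidean_space) chart \<Rightarrow> bool" where
  "is_chart c \<longleftrightarrow> open (cdom c) \<and>
     (\<exists>\<psi>. homeomorphism (cdom c) (cimage c) (cmap c) \<psi>) \<and>
     (open (cimage c) \<or> (\<exists>b\<in>Basis. openin (top_of_set {x. 0 \<le> x \<bullet> b}) (cimage c)))"

definition compatible_charts ::
    "('m::topological_space, 'e::euclidean_space) chart \<Rightarrow> ('m, 'e) chart \<Rightarrow> bool" where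
  "compatible_charts c d \<longleftrightarrow>
     real_analytic_on (cmap c ` (cdom c \<inter> cdom d)) (transition c d) \<and>
     real_analytic_on (cmap d ` (cdom c \<inter> cdom d)) (transition d c)"

definition real_analytic_atlas :: "('m::topological_space, 'e::euclidean_space) chart set \<Rightarrow> bool" where
  "real_analytic_atlas A \<longleftrightarrow> (\<forall>c\<in>A. is_chart c) \<and> (\<Union>c\<in>A. cdom c) = UNIV \<and>
     (\<forall>c\<in>A. \<forall>d\<in>A. compatible_charts c d)"

definition maximal_atlas ::
    "('m::topological_space, 'e::euclidean_space) chart set \<Rightarrow> ('m, 'e) chart set" where
  "maximal_atlas A = {c. is_chart c \<and> (\<forall>d\<in>A. compatible_charts c d)}"

definition manifold_boundary ::
    "('m::topological_space, 'e::euclidean_space) chart set \<Rightarrow> 'm set" where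
  "manifold_boundary A = {p. \<exists>c\<in>A. p \<in> cdom c \<and> cmap c p \<notin> interior (cimage c)}"

definition real_analytic_function ::
    "('m::topological_space, 'e::euclidean_space) chart set \<Rightarrow> ('m \<Rightarrow> real) \<Rightarrow> bool" where
  "real_analytic_function A f \<longleftrightarrow> (\<forall>c\<in>A. real_analytic_on (cimage c) (in_chart c f))"

text \<open>\<^term>\<open>S\<close> is an embedded real analytic hypersurface, without boundary, of the open set
  \<^term>\<open>\<Omega>\<close>: around each of its points there is an analytic chart, onto an open subset of the model
  space, carrying \<^term>\<open>S\<close> onto a full hyperplane slice. In particular such points are not in the
  boundary of the manifold.\<close>

definition analytic_hypersurface ::
    "('m::topological_space, 'e::euclidean_space) chart set \<Rightarrow> 'm set \<Rightarrow> 'm set \<Rightarrow> bool" where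
  "analytic_hypersurface A \<Omega> S \<longleftrightarrow> S \<subseteq> \<Omega> \<and>
     (\<forall>p\<in>S. \<exists>c\<in>maximal_atlas A. \<exists>b\<in>Basis.
        p \<in> cdom c \<and> cdom c \<subseteq> \<Omega> \<and> open (cimage c) \<and>
        cmap c ` (cdom c \<inter> S) = cimage c \<inter> {x. x \<bullet> b = 0})"


section \<open>Riemannian metrics and the Hessian\<close>

text \<open>A covariant 2-tensor field is given by its local representations: \<^term>\<open>h c x u v\<close> is the value,
  at the point with coordinates \<^term>\<open>x\<close> in the chart \<^term>\<open>c\<close>, on the tangent vectors that have
  components \<^term>\<open>u\<close> and \<^term>\<open>v\<close> in that chart.\<close>

type_synonym ('m, 'e) tensor2 = "('m, 'e) chart \<Rightarrow> 'e \<Rightarrow> 'e \<Rightarrow> 'e \<Rightarrow> real"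

definition tensor2_field ::
    "('m::topological_space, 'e::euclidean_space) chart set \<Rightarrow> ('m, 'e) tensor2 \<Rightarrow> bool" where
  "tensor2_field A h \<longleftrightarrow>
     (\<forall>c\<in>A. \<forall>x\<in>cimage c. bilinear (h c x)) \<and>
     (\<forall>c\<in>A. \<forall>d\<in>A. \<forall>p\<in>cdom c \<inter> cdom d. \<forall>u v.
        let D = dir_deriv (cmap c ` (cdom c \<inter> cdom d)) (transition c d) (cmap c p)
        in h c (cmap c p) u v = h d (cmap d p) (D u) (D v))"

definition real_analytic_metric ::
    "('m::topological_space, 'e::euclidean_space) chart set \<Rightarrow> ('m, 'e) tensor2 \<Rightarrow> bool" where
  "real_analytic_metric A g \<longleftrightarrow> tensor2_field A g \<and>
     (\<forall>c\<in>A. \<forall>x\<in>cimage c. (\<forall>u v. g c x u v = g c x v u) \<and> (\<forall>u. u \<noteq> 0 \<longrightarrow> 0 < g c x u u)) \<and>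
     (\<forall>c\<in>A. \<forall>u v. real_analytic_on (cimage c) (\<lambda>x. g c x u v))"

definition real_analytic_riemannian_manifold ::
    "('m::topological_space, 'e::euclidean_space) chart set \<Rightarrow> ('m, 'e) tensor2 \<Rightarrow> bool" where
  "real_analytic_riemannian_manifold A g \<longleftrightarrow> real_analytic_atlas A \<and> real_analytic_metric A g"

text \<open>Christoffel symbols of the Levi-Civita connection in a chart, by the Koszul formula: this is
  the covariant derivative in direction \<^term>\<open>u\<close> of the vector field with constant
  components \<^term>\<open>v\<close>.\<close>

definition christoffel :: "('m, 'e::euclidean_space) tensor2 \<Rightarrow> ('m, 'e) chart \<Rightarrow> 'e \<Rightarrow> 'e \<Rightarrow> 'e \<Rightarrow> 'e" where
  "christoffel g c x u v = (THE z. \<forall>w. g c x z w =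
     (dir_deriv (cimage c) (\<lambda>y. g c y v w) x u + dir_deriv (cimage c) (\<lambda>y. g c y u w) x v
        - dir_deriv (cimage c) (\<lambda>y. g c y u v) x w) / 2)"

definition hessian :: "('m, 'e::euclidean_space) tensor2 \<Rightarrow> ('m \<Rightarrow> real) \<Rightarrow> ('m, 'e) tensor2" where
  "hessian g f c x u v =
     dir_deriv (cimage c) (\<lambda>y. dir_deriv (cimage c) (in_chart c f) y v) x u
       - dir_deriv (cimage c) (in_chart c f) x (christoffel g c x u v)"

definition tensor2_vanishes_at ::
    "('m, 'e::euclidean_space) chart set \<Rightarrow> ('m, 'e) tensor2 \<Rightarrow> 'm \<Rightarrow> bool" where
  "tensor2_vanishes_at A h p \<longleftrightarrow> (\<forall>c\<in>A. p \<in> cdom c \<longrightarrow> (\<forall>u v. h c (cmap c p) u v = 0))"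


section \<open>Maximum set and top stratum\<close>

definition MAX_set :: "('m \<Rightarrow> real) \<Rightarrow> 'm set" where
  "MAX_set f = {x. f x = (SUP y. f y)}"

definition top_stratum ::
    "('m::topological_space, 'e::euclidean_space) chart set \<Rightarrow> ('m \<Rightarrow> real) \<Rightarrow> 'm set" where
  "top_stratum A f =
     {p \<in> MAX_set f. \<exists>\<Omega>. open \<Omega> \<and> p \<in> \<Omega> \<and> analytic_hypersurface A \<Omega> (\<Omega> \<inter> MAX_set f)}"


section \<open>Riemannian distance and completeness\<close>

text \<open>Curves that are continuously differentiable on the unit interval, not necessarily regular,
  and run inside \<^term>\<open>S\<close>. Dropping regularity allows reparametrisations with zero velocity at
  corners, so that piecewise C1 curves would give the same distance.\<close>

definition C1_curve_in ::
    "('m::topological_space, 'e::euclidean_space) chart set \<Rightarrow> 'm set \<Rightarrow> (real \<Rightarrow> 'm) \<Rightarrow> bool" where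
  "C1_curve_in A S \<gamma> \<longleftrightarrow> \<gamma> ` {0..1} \<subseteq> S \<and> continuous_on {0..1} \<gamma> \<and>
     (\<forall>c\<in>A. \<exists>D. continuous_on {t\<in>{0..1}. \<gamma> t \<in> cdom c} D \<and>
        (\<forall>t\<in>{t\<in>{0..1}. \<gamma> t \<in> cdom c}.
           ((cmap c \<circ> \<gamma>) has_vector_derivative D t) (at t within {0..1})))"

definition speed ::
    "('m, 'e::euclidean_space) chart set \<Rightarrow> ('m, 'e) tensor2 \<Rightarrow> (real \<Rightarrow> 'm) \<Rightarrow> real \<Rightarrow> real" where
  "speed A g \<gamma> t = (THE s. \<forall>c\<in>A. \<gamma> t \<in> cdom c \<longrightarrow>
     (let v = vector_derivative (cmap c \<circ> \<gamma>) (at t within {0..1})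
      in s = sqrt (g c (cmap c (\<gamma> t)) v v)))"

text \<open>For an embedded submanifold \<^term>\<open>S\<close> this is the distance of the metric that \<^term>\<open>g\<close> induces
  on \<^term>\<open>S\<close>, and for \<^term>\<open>S = UNIV\<close> it is the distance of the whole manifold. It is infinite
  between points that no curve in \<^term>\<open>S\<close> joins.\<close>

definition intrinsic_dist ::
    "('m::topological_space, 'e::euclidean_space) chart set \<Rightarrow> ('m, 'e) tensor2 \<Rightarrow> 'm set \<Rightarrow> 'm \<Rightarrow> 'm \<Rightarrow> ennreal"
  where
  "intrinsic_dist A g S p q =
     (INF \<gamma>\<in>{\<gamma>. C1_curve_in A S \<gamma> \<and> \<gamma> 0 = p \<and> \<gamma> 1 = q}. ennreal (integral {0..1} (speed A g \<gamma>)))"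

text \<open>Metric completeness. The limit is taken in the topology of the manifold; for an embedded
  submanifold its subspace topology is the topology of the intrinsic distance.\<close>

definition intrinsically_complete ::
    "('m::topological_space, 'e::euclidean_space) chart set \<Rightarrow> ('m, 'e) tensor2 \<Rightarrow> 'm set \<Rightarrow> bool" where
  "intrinsically_complete A g S \<longleftrightarrow>
     (\<forall>X :: nat \<Rightarrow> 'm. range X \<subseteq> S \<and>
        (\<forall>e>0. \<exists>N. \<forall>i\<ge>N. \<forall>j\<ge>N. intrinsic_dist A g S (X i) (X j) < e) \<longrightarrow>
        (\<exists>p\<in>S. X \<longlonglongrightarrow> p))"

end

theory Submission
  imports Defs "HOL-Complex_Analysis.Cauchy_Integral_Formula"
begin

text \<open>At a maximum the differential of \<open>f\<close> vanishes, so in a chart the Hessian is the matrix of second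
  derivatives. If it is nonzero at a point \<open>p\<close> of the closure of the stratum, some directional
  derivative \<open>G\<close> of \<open>f\<close> has nonzero differential at \<open>p\<close>, and by the analytic inverse function theorem
  \<open>G\<close> is a coordinate of an analytic chart onto a ball around the image of \<open>p\<close>. All maxima in this chart
  lie in the hyperplane \<open>G = 0\<close>. Near a point of the stratum the maximum set is a hypersurface contained
  in that hyperplane, hence open in it by invariance of domain. So the analytic function
  \<open>f - max f\<close>, restricted to the hyperplane, vanishes on a nonempty open set and thus everywhere, and
  the maximum set is the whole hyperplane slice. Completeness passes to closed subsets because the
  intrinsic distance of a subset dominates the distance of the manifold.

  The local theory of real analytic functions of several variables rests on the weighted
  \<open>l\<^sup>1\<close>-norm of the coefficients, which is submultiplicative.\<close>

section \<open>Majorized power series\<close>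

text \<open>One nonzero second derivative is enough, whatever the rank of the Hessian: it makes some
  first derivative \<open>G\<close> a coordinate, and \<open>G\<close> vanishes at all nearby maxima
  because each of them is an interior critical point. This gives only one inclusion, since the
  maximum set could still be a proper part of the hyperplane. Points of the stratum near
  \<open>p\<close> come with unrelated charts of their own; comparing the two flattened pictures
  takes only continuity, injectivity and equality of dimensions, hence invariance of domain. To
  spread the vanishing over the slice, the function is precomposed with the orthogonal projection
  onto the hyperplane, so that an identity theorem on a ball of the full space suffices.
  Disjointness from the boundary makes the derivatives at \<open>p\<close> ordinary two-sided ones
  and gives the new chart an open image. The norm bounds use cubes with one common radius, because
  then a bound on each component of a map is exactly what substitution requires.\<close>

abbreviation multi_indices :: "('a::euclidean_space \<Rightarrow> nat) set" where
  "multi_indices \<equiv> Basis \<rightarrow>\<^sub>E UNIV"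

definition monomial :: "'a::euclidean_space \<Rightarrow> ('a \<Rightarrow> nat) \<Rightarrow> real" where
  "monomial x \<alpha> = (\<Prod>i\<in>Basis. (x \<bullet> i) ^ \<alpha> i)"

definition deg :: "('a::euclidean_space \<Rightarrow> nat) \<Rightarrow> nat" where
  "deg \<alpha> = (\<Sum>i\<in>Basis. \<alpha> i)"

text \<open>Cubes rather than balls: on \<open>cube s\<close> a monomial is bounded by
  \<open>s ^ deg \<alpha>\<close>, and the corner with all coordinates \<open>s\<close> attains this
  bound. So absolute convergence at the corner is finiteness of the weighted norm.\<close>

definition cube :: "real \<Rightarrow> 'a::euclidean_space set" where
  "cube s = {x. \<forall>i\<in>Basis. \<bar>x \<bullet> i\<bar> \<le> s}"

text \<open>\<open>f\<close> is the sum of a power series at the origin whose weighted \<open>l\<^sup>1\<close>-norm at radius \<open>s\<close> is at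
  most \<open>N\<close>.\<close>

definition majorized :: "real \<Rightarrow> real \<Rightarrow> ('a::euclidean_space \<Rightarrow> real) \<Rightarrow> bool" where
  "majorized s N f \<longleftrightarrow> (\<exists>C M. M \<le> N \<and> ((\<lambda>\<alpha>. \<bar>C \<alpha>\<bar> * s ^ deg \<alpha>) has_sum M) multi_indices \<and>
     (\<forall>x\<in>cube s. ((\<lambda>\<alpha>. C \<alpha> * monomial x \<alpha>) has_sum f x) multi_indices))"

section \<open>Monomials, cubes and regrouping of monomial families\<close>

lemma abs_monomial_le:
  assumes "x \<in> cube s" shows "\<bar>monomial x \<alpha>\<bar> \<le> s ^ deg \<alpha>"
proof -
  have "\<bar>monomial x \<alpha>\<bar> = (\<Prod>i\<in>Basis. \<bar>x \<bullet> i\<bar> ^ \<alpha> i)"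
    by (simp add: monomial_def abs_prod power_abs)
  also have "\<dots> \<le> (\<Prod>i\<in>(Basis::'a set). s ^ \<alpha> i)"
    using assms by (intro prod_mono) (auto simp: cube_def intro!: power_mono)
  also have "\<dots> = s ^ deg \<alpha>" by (simp add: deg_def power_sum)
  finally show ?thesis .
qed

lemma monomial_add:
  "monomial x (restrict (\<lambda>i. \<alpha> i + \<beta> i) Basis) = monomial x \<alpha> * monomial x \<beta>"
  by (simp add: monomial_def power_add prod.distrib)

lemma deg_add: "deg (restrict (\<lambda>i. \<alpha> i + \<beta> i) Basis) = deg \<alpha> + deg \<beta>"
  by (simp add: deg_def sum.distrib)

lemma cube_mono: "s \<le> t \<Longrightarrow> cube s \<subseteq> cube t"
  unfolding cube_def by fastforce

lemma zero_in_cube: "0 \<le> s \<Longrightarrow> 0 \<in> cube s"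
  by (simp add: cube_def)

lemma ball_subset_cube: "ball 0 s \<subseteq> cube s"
proof
  fix x :: 'a assume "x \<in> ball 0 s"
  then show "x \<in> cube s"
    unfolding cube_def using Basis_le_norm[of _ x] by fastforce
qed

lemma cube_nhds: "0 < s \<Longrightarrow> \<forall>\<^sub>F x in nhds 0. x \<in> cube s"
  using ball_subset_cube[of s]  by (auto simp: eventually_nhds intro!: exI[of _ "ball 0 s"])

lemma eventually_nhds_cube:
  assumes "\<forall>\<^sub>F x in nhds (0::'a::euclidean_space). P x"
  obtains r where "0 < r" "\<And>x. x \<in> cube r \<Longrightarrow> P x"
proof -
  from assms obtain e where e: "0 < e" "\<And>x. x \<in> ball 0 e \<Longrightarrow> P x"
    by (auto simp: eventually_nhds_metric dist_commute)
  \<comment> \<open>Dividing by the dimension turns the coordinatewise bound of the cube into a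
    bound \<open>e / 2\<close> on the sum of the absolute coordinates, which dominates the Euclidean
    norm.\<close>
  define r where "r = e / (2 * real DIM('a))"
  have "0 < r" using e by (simp add: r_def)
  moreover have "P x" if "x \<in> cube r" for x
  proof (rule e)
    have "norm x \<le> (\<Sum>i\<in>Basis. \<bar>x \<bullet> i\<bar>)" by (rule norm_le_l1)
    also have "\<dots> \<le> of_nat DIM('a) * r" using that by (intro sum_bounded_above) (auto simp: cube_def)
    also have "\<dots> = e / 2" by (simp add: r_def)
    finally show "x \<in> ball 0 e" using e by simp
  qed
  ultimately show ?thesis by (rule that)
qed

text \<open>Any absolutely convergent family of monomials can be collected into a power series; sums,
  products and compositions of power series all arise as such families.\<close>

lemma majorized_regroup:
  fixes f :: "'a::euclidean_space \<Rightarrow> real" and c :: "'k \<Rightarrow> real"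
  assumes s: "0 < s" and a: "a ` K \<subseteq> multi_indices"
    and M: "((\<lambda>k. \<bar>c k\<bar> * s ^ deg (a k)) has_sum M) K" "M \<le> N"
    and f: "\<And>x. x \<in> cube s \<Longrightarrow> f x = (\<Sum>\<^sub>\<infinity>k\<in>K. c k * monomial x (a k))"
  shows "majorized s N f"
proof -
  \<comment> \<open>\<open>F \<alpha>\<close> is the fibre of \<open>a\<close> over the exponent
    \<open>\<alpha>\<close>; collecting it gives the coefficient \<open>D \<alpha>\<close>, with
    \<open>\<bar>D \<alpha>\<bar> \<le> n \<alpha>\<close>. Summing over fibres first shows that the
    weighted sum of \<open>n\<close> is exactly \<open>M\<close>.\<close>
  define F where "F \<alpha> = {k\<in>K. a k = \<alpha>}" for \<alpha>
  define D where "D \<alpha> = (\<Sum>\<^sub>\<infinity>k\<in>F \<alpha>. c k)" for \<alpha>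
  define n where "n \<alpha> = (\<Sum>\<^sub>\<infinity>k\<in>F \<alpha>. \<bar>c k\<bar>)" for \<alpha>
  let ?S = "Sigma multi_indices F"
  have bij: "bij_betw (\<lambda>k. (a k, k)) K ?S"
    using a by (intro bij_betwI[where g=snd]) (auto simp: F_def)
  have X: "((\<lambda>(\<alpha>,k). \<bar>c k\<bar> * s ^ deg \<alpha>) has_sum M) ?S"
    using has_sum_reindex_bij_betw[OF bij, of "\<lambda>(\<alpha>,k). \<bar>c k\<bar> * s ^ deg \<alpha>" M] M by simp
  have sc: "(\<lambda>k. \<bar>c k\<bar>) summable_on F \<alpha>" if "\<alpha> \<in> multi_indices" for \<alpha>
  proof -
    have "(\<lambda>k. \<bar>c k\<bar> * s ^ deg \<alpha>) summable_on F \<alpha>"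
      using summable_on_SigmaD1[of "\<lambda>\<alpha> k. \<bar>c k\<bar> * s ^ deg \<alpha>"] X that
      by (metis (mono_tags, lifting) has_sum_imp_summable)
    then have "(\<lambda>k. \<bar>c k\<bar> * s ^ deg \<alpha> * inverse (s ^ deg \<alpha>)) summable_on F \<alpha>"
      by (rule summable_on_cmult_left)
    then show ?thesis using s by (simp add: mult.assoc)
  qed
  have sc': "c summable_on F \<alpha>" if "\<alpha> \<in> multi_indices" for \<alpha>
    using sc[OF that] by (subst summable_on_iff_abs_summable_on_real) simp
  have nM: "((\<lambda>\<alpha>. n \<alpha> * s ^ deg \<alpha>) has_sum M) multi_indices"
    using X unfolding n_def
    by (rule has_sum_SigmaD) (use sc in \<open>auto intro!: has_sum_cmult_left\<close>)
  have Dn: "\<bar>D \<alpha>\<bar> \<le> n \<alpha>" if "\<alpha> \<in> multi_indices" for \<alpha>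
    unfolding D_def n_def using norm_infsum_bound[of c "F \<alpha>"] sc[OF that] by simp
  have le: "\<bar>D \<alpha>\<bar> * s ^ deg \<alpha> \<le> n \<alpha> * s ^ deg \<alpha>" if "\<alpha> \<in> multi_indices" for \<alpha>
    using Dn[OF that] s by (intro mult_right_mono) auto
  have Ds: "(\<lambda>\<alpha>. \<bar>D \<alpha>\<bar> * s ^ deg \<alpha>) summable_on multi_indices"
    by (rule summable_on_comparison_test[of "\<lambda>\<alpha>. n \<alpha> * s ^ deg \<alpha>"])
      (use nM le s in \<open>auto intro: has_sum_imp_summable\<close>)
  have "(\<Sum>\<^sub>\<infinity>\<alpha>\<in>multi_indices. \<bar>D \<alpha>\<bar> * s ^ deg \<alpha>) \<le> M"
    by (rule has_sum_mono[OF has_sum_infsum[OF Ds] nM]) (rule le)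
  then have *: "(\<Sum>\<^sub>\<infinity>\<alpha>\<in>multi_indices. \<bar>D \<alpha>\<bar> * s ^ deg \<alpha>) \<le> N"
    using M by simp
  have "((\<lambda>\<alpha>. D \<alpha> * monomial x \<alpha>) has_sum f x) multi_indices" if x: "x \<in> cube s" for x
  proof -
    have "(\<lambda>k. \<bar>c k * monomial x (a k)\<bar>) summable_on K"
      by (rule summable_on_comparison_test[OF has_sum_imp_summable[OF M(1)]])
        (use abs_monomial_le[OF x] s in \<open>auto simp: abs_mult intro!: mult_left_mono\<close>)
    then have "(\<lambda>k. c k * monomial x (a k)) summable_on K"
      by (subst summable_on_iff_abs_summable_on_real) simp
    then have "((\<lambda>k. c k * monomial x (a k)) has_sum f x) K"
      by (simp add: f[OF x])
    then have "((\<lambda>(\<alpha>,k). c k * monomial x \<alpha>) has_sum f x) ?S"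
      using has_sum_reindex_bij_betw[OF bij, of "\<lambda>(\<alpha>,k). c k * monomial x \<alpha>" "f x"] by simp
    then show ?thesis unfolding D_def
      by (rule has_sum_SigmaD) (use sc' in \<open>auto intro!: has_sum_cmult_left\<close>)
  qed
  with * Ds show ?thesis
    unfolding majorized_def using has_sum_infsum by blast
qed

section \<open>Sums, products and substitution of majorized series\<close>

lemma majorized_mono: "majorized s N f \<Longrightarrow> N \<le> N' \<Longrightarrow> majorized s N' f"
  unfolding majorized_def by (meson order_trans)

lemma majorized_cong: "(\<And>x. x \<in> cube s \<Longrightarrow> f x = g x) \<Longrightarrow> majorized s N f \<longleftrightarrow> majorized s N g"
  unfolding majorized_def by simp

lemma majorized_nonneg: "majorized s N f \<Longrightarrow> 0 \<le> s \<Longrightarrow> 0 \<le> N"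
  unfolding majorized_def
  by (meson abs_ge_zero has_sum_nonneg mult_nonneg_nonneg order_trans zero_le_power)

lemma majorized_abs_le:
  assumes "majorized s N f" "x \<in> cube s" shows "\<bar>f x\<bar> \<le> N"
proof -
  from assms obtain C M where "M \<le> N" "((\<lambda>\<alpha>. \<bar>C \<alpha>\<bar> * s ^ deg \<alpha>) has_sum M) multi_indices"
    "((\<lambda>\<alpha>. C \<alpha> * monomial x \<alpha>) has_sum f x) multi_indices"
    by (auto simp: majorized_def)
  note C = this
  have "norm (f x) \<le> M"
    by (rule norm_infsum_le[OF C(3,2)])
      (use abs_monomial_le[OF assms(2)] in \<open>auto simp: abs_mult intro!: mult_left_mono\<close>)
  with \<open>M \<le> N\<close> show ?thesis by simp
qed

lemma zero_multi_index: "restrict (\<lambda>_. 0) Basis \<in> multi_indices" by auto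

lemma multi_index_nonzero:
  assumes "\<alpha> \<in> multi_indices" "\<alpha> \<noteq> restrict (\<lambda>_. 0) Basis"
  obtains i where "i \<in> Basis" "\<alpha> i \<noteq> 0"
proof -
  obtain x where "\<alpha> x \<noteq> restrict (\<lambda>_. 0) Basis x"
    using assms(2) by (auto simp: fun_eq_iff)
  then show ?thesis
    using assms(1) that[of x] by (cases "x \<in> Basis") (auto simp: PiE_def extensional_def)
qed

lemma majorized_const:
  assumes "0 < s" "\<bar>c\<bar> \<le> N" shows "majorized s N (\<lambda>x::'a::euclidean_space. c)"
proof (rule majorized_regroup[where K="{()}" and c="\<lambda>_. c" and a="\<lambda>_. restrict (\<lambda>_. 0) Basis" and M="\<bar>c\<bar>"])
qed (use assms in \<open>auto simp: deg_def monomial_def intro!: has_sum_finiteI\<close>)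

lemma majorized_coord:
  assumes "0 < s" "i \<in> Basis" shows "majorized s s (\<lambda>x::'a::euclidean_space. x \<bullet> i)"
proof (rule majorized_regroup[where K="{()}" and c="\<lambda>_. 1" and M=s
      and a="\<lambda>_. restrict (\<lambda>j. if j = i then 1 else 0) Basis"])
  have "(\<Prod>j\<in>Basis. (x \<bullet> j) ^ (if j = i then 1 else 0)) = x \<bullet> i" for x :: 'a
    using assms(2) by (subst prod.cong[OF refl, of _ _ "\<lambda>j. if j = i then x \<bullet> i else 1"]) auto
  then show "x \<bullet> i = (\<Sum>\<^sub>\<infinity>k\<in>{()}. 1 * monomial x (restrict (\<lambda>j. if j = i then 1 else 0) Basis))" for x :: 'a
    by (simp add: monomial_def)
qed (use assms in \<open>auto simp: deg_def intro!: has_sum_finiteI\<close>)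

text \<open>Completeness of the weighted norm: summability of the bounds \<open>N k\<close> makes
  the double family over \<open>K \<times> multi_indices\<close> absolutely summable, so it may be
  regrouped by exponents.\<close>

lemma majorized_infsum:
  fixes f :: "'k \<Rightarrow> 'a::euclidean_space \<Rightarrow> real"
  assumes s: "0 < s" and f: "\<And>k. k \<in> K \<Longrightarrow> majorized s (N k) (f k)"
    and N: "(N has_sum T) K" and h: "\<And>x. x \<in> cube s \<Longrightarrow> h x = (\<Sum>\<^sub>\<infinity>k\<in>K. f k x)"
  shows "majorized s T h"
proof -
  from f have "\<forall>k\<in>K. \<exists>C M. M \<le> N k \<and> ((\<lambda>\<alpha>. \<bar>C \<alpha>\<bar> * s ^ deg \<alpha>) has_sum M) multi_indices \<and>
     (\<forall>x\<in>cube s. ((\<lambda>\<alpha>. C \<alpha> * monomial x \<alpha>) has_sum f k x) multi_indices)"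
    by (simp add: majorized_def)
  then obtain C M where "\<forall>k\<in>K. M k \<le> N k \<and> ((\<lambda>\<alpha>. \<bar>C k \<alpha>\<bar> * s ^ deg \<alpha>) has_sum M k) multi_indices \<and>
     (\<forall>x\<in>cube s. ((\<lambda>\<alpha>. C k \<alpha> * monomial x \<alpha>) has_sum f k x) multi_indices)"
    unfolding bchoice_iff by blast
  then have C: "\<And>k. k \<in> K \<Longrightarrow> M k \<le> N k"
    "\<And>k. k \<in> K \<Longrightarrow> ((\<lambda>\<alpha>. \<bar>C k \<alpha>\<bar> * s ^ deg \<alpha>) has_sum M k) multi_indices"
    "\<And>k x. k \<in> K \<Longrightarrow> x \<in> cube s \<Longrightarrow> ((\<lambda>\<alpha>. C k \<alpha> * monomial x \<alpha>) has_sum f k x) multi_indices"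
    by auto
  have M0: "0 \<le> M k" if "k \<in> K" for k
    by (rule has_sum_nonneg[OF C(2)[OF that]]) (use s in auto)
  have Ms: "M summable_on K"
    by (rule summable_on_comparison_test[OF has_sum_imp_summable[OF N]]) (use C M0 in auto)
  have MT: "infsum M K \<le> T"
    by (rule has_sum_mono[OF has_sum_infsum[OF Ms] N]) (use C in auto)
  have S: "(\<lambda>(k,\<alpha>). \<bar>C k \<alpha>\<bar> * s ^ deg \<alpha>) summable_on (K \<times> multi_indices)"
    by (rule summable_on_SigmaI[OF _ Ms]) (use C s in auto)
  have S': "((\<lambda>(k,\<alpha>). \<bar>C k \<alpha>\<bar> * s ^ deg \<alpha>) has_sum infsum M K) (K \<times> multi_indices)"
    by (rule has_sum_SigmaI[OF _ has_sum_infsum[OF Ms] S]) (use C in auto)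
  show ?thesis
  proof (rule majorized_regroup[OF s _ _ MT, where K="K \<times> multi_indices" and a=snd and c="\<lambda>(k,\<alpha>). C k \<alpha>"])
    show "((\<lambda>k. \<bar>case k of (k, \<alpha>) \<Rightarrow> C k \<alpha>\<bar> * s ^ deg (snd k)) has_sum infsum M K) (K \<times> multi_indices)"
      using S' by (simp add: case_prod_unfold)
    fix x :: 'a assume x: "x \<in> cube s"
    have "(\<lambda>(k,\<alpha>). \<bar>C k \<alpha> * monomial x \<alpha>\<bar>) summable_on (K \<times> multi_indices)"
      by (rule summable_on_comparison_test[OF S])
        (use abs_monomial_le[OF x] s in \<open>auto simp: abs_mult intro!: mult_left_mono\<close>)
    then have "(\<lambda>(k,\<alpha>). C k \<alpha> * monomial x \<alpha>) summable_on (K \<times> multi_indices)"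
      by (subst summable_on_iff_abs_summable_on_real) (simp add: case_prod_unfold)
    from has_sum_SigmaD[OF has_sum_infsum[OF this], where g = "\<lambda>k. f k x"] C(3) x
    have "((\<lambda>k. f k x) has_sum (\<Sum>\<^sub>\<infinity>(k,\<alpha>)\<in>K \<times> multi_indices. C k \<alpha> * monomial x \<alpha>)) K"
      by simp
    then show "h x = (\<Sum>\<^sub>\<infinity>k\<in>K \<times> multi_indices. (case k of (k, \<alpha>) \<Rightarrow> C k \<alpha>) * monomial x (snd k))"
      by (simp add: h[OF x] infsumI case_prod_unfold)
  qed auto
qed

lemma majorized_sum:
  assumes "0 < s" "finite K" "\<And>k. k \<in> K \<Longrightarrow> majorized s (N k) (f k)"
  shows "majorized s (sum N K) (\<lambda>x. \<Sum>k\<in>K. f k x)"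
  by (rule majorized_infsum[OF assms(1,3)]) (use assms(2) in auto)

lemma majorized_add:
  assumes "0 < s" "majorized s N f" "majorized s N' g"
  shows "majorized s (N + N') (\<lambda>x. f x + g x)"
  using majorized_sum[OF assms(1), of "UNIV::bool set" "\<lambda>b. if b then N else N'" "\<lambda>b. if b then f else g"] assms
  by (simp add: UNIV_bool add_ac)

text \<open>The Cauchy product is kept as a family indexed by pairs of exponents; since degrees add,
  its weighted norm factors into \<open>M * L\<close>.\<close>

lemma majorized_mult:
  fixes f :: "'a::euclidean_space \<Rightarrow> real"
  assumes s: "0 < s" and f: "majorized s N f" and g: "majorized s N' g"
  shows "majorized s (N * N') (\<lambda>x. f x * g x)"
proof -
  from f obtain C M where C: "M \<le> N" "((\<lambda>\<alpha>. \<bar>C \<alpha>\<bar> * s ^ deg \<alpha>) has_sum M) multi_indices"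
    "\<And>x. x \<in> cube s \<Longrightarrow> ((\<lambda>\<alpha>. C \<alpha> * monomial x \<alpha>) has_sum f x) multi_indices"
    by (auto simp: majorized_def)
  from g obtain D L where D: "L \<le> N'" "((\<lambda>\<alpha>. \<bar>D \<alpha>\<bar> * s ^ deg \<alpha>) has_sum L) multi_indices"
    "\<And>x. x \<in> cube s \<Longrightarrow> ((\<lambda>\<alpha>. D \<alpha> * monomial x \<alpha>) has_sum g x) multi_indices"
    by (auto simp: majorized_def)
  let ?E = "multi_indices :: ('a \<Rightarrow> nat) set"
  have prod: "((\<lambda>(\<alpha>,\<beta>). u \<alpha> * v \<beta>) has_sum U * V) (?E \<times> ?E)"
    if u: "(u has_sum U) ?E" and v: "(v has_sum V) ?E" for u v :: "('a \<Rightarrow> nat) \<Rightarrow> real" and U V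
  proof (rule has_sum_SigmaI[where g="\<lambda>\<alpha>. u \<alpha> * V"])
    have au: "(\<lambda>\<alpha>. \<bar>u \<alpha>\<bar>) summable_on ?E" and av: "(\<lambda>\<alpha>. \<bar>v \<alpha>\<bar>) summable_on ?E"
      using u v summable_on_iff_abs_summable_on_real[of u] summable_on_iff_abs_summable_on_real[of v]
      by (auto dest: has_sum_imp_summable)
    have "(\<lambda>(\<alpha>,\<beta>). \<bar>u \<alpha>\<bar> * \<bar>v \<beta>\<bar>) summable_on (?E \<times> ?E)"
      by (rule summable_on_SigmaI[OF _ summable_on_cmult_left[OF au]])
        (use has_sum_infsum[OF av] in \<open>auto intro!: has_sum_cmult_right\<close>)
    then show "(\<lambda>(\<alpha>,\<beta>). u \<alpha> * v \<beta>) summable_on (?E \<times> ?E)"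
      by (subst summable_on_iff_abs_summable_on_real) (simp add: case_prod_unfold abs_mult)
  qed (use u v in \<open>auto intro!: has_sum_cmult_left has_sum_cmult_right\<close>)
  have M0: "0 \<le> M" "0 \<le> L"
    by (rule has_sum_nonneg[OF C(2)] has_sum_nonneg[OF D(2)], use s in auto)+
  show ?thesis
  proof (rule majorized_regroup[OF s, where K="?E \<times> ?E" and M="M * L" and c="\<lambda>(\<alpha>,\<beta>). C \<alpha> * D \<beta>"
      and a="\<lambda>(\<alpha>,\<beta>). restrict (\<lambda>i. \<alpha> i + \<beta> i) Basis"])
    show "((\<lambda>k. \<bar>case k of (\<alpha>, \<beta>) \<Rightarrow> C \<alpha> * D \<beta>\<bar> *
             s ^ deg (case k of (\<alpha>, \<beta>) \<Rightarrow> \<lambda>i\<in>Basis. \<alpha> i + \<beta> i)) has_sum M * L) (?E \<times> ?E)"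
      using prod[OF C(2) D(2)] by (simp add: case_prod_unfold deg_add power_add abs_mult mult_ac)
    show "M * L \<le> N * N'" using M0 C D by (intro mult_mono) auto
    fix x :: 'a assume x: "x \<in> cube s"
    show "f x * g x = (\<Sum>\<^sub>\<infinity>k\<in>?E \<times> ?E. (case k of (\<alpha>, \<beta>) \<Rightarrow> C \<alpha> * D \<beta>) *
         monomial x (case k of (\<alpha>, \<beta>) \<Rightarrow> \<lambda>i\<in>Basis. \<alpha> i + \<beta> i))"
      using prod[OF C(3)[OF x] D(3)[OF x], THEN infsumI]
      by (simp add: case_prod_unfold monomial_add mult_ac)
  qed auto
qed

lemma majorized_cmult:
  "0 < s \<Longrightarrow> majorized s N f \<Longrightarrow> majorized s (\<bar>c\<bar> * N) (\<lambda>x. c * f x)"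
  by (intro majorized_mult majorized_const) auto

lemma majorized_uminus: "0 < s \<Longrightarrow> majorized s N f \<Longrightarrow> majorized s N (\<lambda>x. - f x)"
  using majorized_cmult[of s N f "-1"] by simp

lemma majorized_power:
  assumes "0 < s" "majorized s N f"
  shows "majorized s (N ^ n) (\<lambda>x. f x ^ n)"
  by (induction n) (use assms in \<open>auto intro!: majorized_const majorized_mult\<close>)

lemma majorized_prod:
  assumes "0 < s" "finite K" "\<And>k. k \<in> K \<Longrightarrow> majorized s (N k) (f k)"
  shows "majorized s (prod N K) (\<lambda>x. \<Prod>k\<in>K. f k x)"
  using assms(2,3) by (induction K rule: finite_induct)
   (use assms(1) in \<open>auto intro!: majorized_const majorized_mult\<close>)

text \<open>By submultiplicativity, substituting components of norm at most \<open>t\<close> into a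
  monomial gives norm at most \<open>t ^ deg \<alpha>\<close>, so the weighted coefficient sum of
  \<open>f\<close> at radius \<open>t\<close> bounds the composite.\<close>

lemma majorized_compose:
  fixes \<phi> :: "'a::euclidean_space \<Rightarrow> 'b::euclidean_space"
  assumes s: "0 < s" "0 < t" and f: "majorized t N f"
    and \<phi>: "\<And>j. j \<in> Basis \<Longrightarrow> majorized s t (\<lambda>x. \<phi> x \<bullet> j)"
  shows "majorized s N (\<lambda>x. f (\<phi> x))"
proof -
  from f obtain C M where C: "M \<le> N" "((\<lambda>\<alpha>. \<bar>C \<alpha>\<bar> * t ^ deg \<alpha>) has_sum M) multi_indices"
    "\<And>x. x \<in> cube t \<Longrightarrow> ((\<lambda>\<alpha>. C \<alpha> * monomial x \<alpha>) has_sum f x) multi_indices"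
    by (auto simp: majorized_def)
  have "majorized s M (\<lambda>x. f (\<phi> x))"
  proof (rule majorized_infsum[OF s(1) _ C(2)])
    fix \<alpha> :: "'b \<Rightarrow> nat"
    have "majorized s (\<Prod>j\<in>Basis. t ^ \<alpha> j) (\<lambda>x. monomial (\<phi> x) \<alpha>)"
      unfolding monomial_def
      using s \<phi> by (intro majorized_prod majorized_power) auto
    then show "majorized s (\<bar>C \<alpha>\<bar> * t ^ deg \<alpha>) (\<lambda>x. C \<alpha> * monomial (\<phi> x) \<alpha>)"
      using s by (intro majorized_cmult) (auto simp: deg_def power_sum)
  next
    fix x :: 'a assume x: "x \<in> cube s"
    have "\<phi> x \<in> cube t"
      unfolding cube_def using majorized_abs_le[OF \<phi> x] by auto
    from C(3)[OF this] show "f (\<phi> x) = (\<Sum>\<^sub>\<infinity>\<alpha>\<in>multi_indices. C \<alpha> * monomial (\<phi> x) \<alpha>)"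
      by (simp add: infsumI)
  qed
  then show ?thesis using C(1) by (rule majorized_mono)
qed

text \<open>Shrinking is substitution of the identity, whose components have norm
  \<open>s \<le> t\<close> at radius \<open>s\<close>.\<close>

lemma majorized_shrink:
  assumes "majorized t N f" "0 < s" "s \<le> t" shows "majorized s N f"
  using majorized_compose[of s t N f "\<lambda>x. x"] assms
  by (auto intro!: majorized_mono[OF majorized_coord])

text \<open>Without constant term every exponent that occurs has degree at least one, so passing
  from \<open>t\<close> to \<open>s\<close> gains at least one factor \<open>s / t\<close>. This is
  the source of small norms in substitution, continuity and Picard iteration.\<close>

lemma majorized_shrink_0:
  fixes f :: "'a::euclidean_space \<Rightarrow> real"
  assumes f: "majorized t N f" "f 0 = 0" and s: "0 < s" "s \<le> t"
  shows "majorized s (s / t * N) f"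
proof -
  from f obtain C M where C: "M \<le> N" "((\<lambda>\<alpha>. \<bar>C \<alpha>\<bar> * t ^ deg \<alpha>) has_sum M) multi_indices"
    "\<And>x. x \<in> cube t \<Longrightarrow> ((\<lambda>\<alpha>. C \<alpha> * monomial x \<alpha>) has_sum f x) multi_indices"
    by (auto simp: majorized_def)
  let ?z = "restrict (\<lambda>_. 0) Basis :: 'a \<Rightarrow> nat"
  have mz: "monomial 0 \<alpha> = (if \<alpha> = ?z then 1 else 0)" if "\<alpha> \<in> multi_indices" for \<alpha> :: "'a \<Rightarrow> nat"
  proof (cases "\<alpha> = ?z")
    case False
    with that obtain i where "i \<in> Basis" "\<alpha> i \<noteq> 0"
      by (rule multi_index_nonzero)
    then show ?thesis using False by (auto simp: monomial_def)
  qed (simp add: monomial_def)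
  \<comment> \<open>Evaluation at the origin leaves only the exponent zero, so the constant
    coefficient is \<open>f 0\<close>.\<close>
  have "((\<lambda>\<alpha>. C \<alpha> * monomial 0 \<alpha>) has_sum C ?z) multi_indices"
    using zero_multi_index by (intro has_sum_finite_neutralI[where B="{?z}"]) (auto simp: mz)
  moreover have "((\<lambda>\<alpha>. C \<alpha> * monomial 0 \<alpha>) has_sum f 0) multi_indices"
    using C(3) s by (auto simp: zero_in_cube)
  ultimately have Cz: "C ?z = 0" using f(2) by (metis has_sum_unique)
  have le: "\<bar>C \<alpha>\<bar> * s ^ deg \<alpha> \<le> (s / t) * (\<bar>C \<alpha>\<bar> * t ^ deg \<alpha>)" if "\<alpha> \<in> multi_indices" for \<alpha>
  proof (cases "\<alpha> = ?z")
    case False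
    with that obtain i where i: "i \<in> Basis" "\<alpha> i \<noteq> 0"
      by (rule multi_index_nonzero)
    have "\<alpha> i \<le> deg \<alpha>" using i by (auto simp: deg_def intro: member_le_sum)
    with i obtain d where d: "deg \<alpha> = Suc d" by (cases "deg \<alpha>") auto
    have "(s / t) ^ d \<le> 1" using s by (intro power_le_one) auto
    then have "s ^ d \<le> t ^ d" using s by (simp add: power_mono)
    then have "s * s ^ d \<le> s * t ^ d" using s by simp
    then have "s ^ deg \<alpha> \<le> s / t * t ^ deg \<alpha>" using s by (simp add: d)
    then have "\<bar>C \<alpha>\<bar> * s ^ deg \<alpha> \<le> \<bar>C \<alpha>\<bar> * (s / t * t ^ deg \<alpha>)" by (intro mult_left_mono) auto
    then show ?thesis by (simp add: mult_ac)
  qed (simp add: Cz)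
  have sm: "((\<lambda>\<alpha>. (s / t) * (\<bar>C \<alpha>\<bar> * t ^ deg \<alpha>)) has_sum (s / t) * M) multi_indices"
    using C(2) by (rule has_sum_cmult_right)
  have sm': "(\<lambda>\<alpha>. \<bar>C \<alpha>\<bar> * s ^ deg \<alpha>) summable_on multi_indices"
    by (rule summable_on_comparison_test[OF has_sum_imp_summable[OF sm]]) (use le s in auto)
  show ?thesis unfolding majorized_def
  proof (intro exI conjI)
    show "((\<lambda>\<alpha>. \<bar>C \<alpha>\<bar> * s ^ deg \<alpha>) has_sum (\<Sum>\<^sub>\<infinity>\<alpha>\<in>multi_indices. \<bar>C \<alpha>\<bar> * s ^ deg \<alpha>)) multi_indices"
      using sm' by simp
    have "(\<Sum>\<^sub>\<infinity>\<alpha>\<in>multi_indices. \<bar>C \<alpha>\<bar> * s ^ deg \<alpha>) \<le> (s / t) * M"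
      by (rule has_sum_mono[OF has_sum_infsum[OF sm'] sm]) (rule le)
    also have "\<dots> \<le> s / t * N" using C(1) s by (intro mult_left_mono) auto
    finally show "(\<Sum>\<^sub>\<infinity>\<alpha>\<in>multi_indices. \<bar>C \<alpha>\<bar> * s ^ deg \<alpha>) \<le> s / t * N" .
    show "\<forall>x\<in>cube s. ((\<lambda>\<alpha>. C \<alpha> * monomial x \<alpha>) has_sum f x) multi_indices"
      using C(3) cube_mono[OF s(2)] by auto
  qed
qed

section \<open>Real analytic functions of several variables\<close>

lemma eventually_cube_at_right:
  assumes "\<forall>\<^sub>F x in nhds (0::'a::euclidean_space). P x"
  shows "\<forall>\<^sub>F s in at_right 0. \<forall>x\<in>cube s. P x"
proof -
  obtain r where r: "0 < r" "\<And>x. x \<in> cube r \<Longrightarrow> P x"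
    using eventually_nhds_cube[OF assms] by blast
  then show ?thesis
    unfolding eventually_at_right_field using cube_mono less_imp_le by (intro exI[of _ r]) blast
qed

lemma eventually_at_right_witness:
  assumes "\<forall>\<^sub>F s in at_right (0::real). P s"
  obtains s where "0 < s" "P s"
  using assms unfolding eventually_at_right_field
  by (meson dense)

definition majorizable :: "('a::euclidean_space \<Rightarrow> real) \<Rightarrow> bool" where
  "majorizable f \<longleftrightarrow> (\<exists>s>0. \<exists>N. majorized s N f)"

text \<open>With one bound valid at all small radii, finitely many functions can be given a common
  radius by intersecting eventualities.\<close>

lemma majorizable_at_right:
  assumes "majorizable f" obtains N where "\<forall>\<^sub>F s in at_right 0. majorized s N f"
proof -
  from assms obtain s N where "0 < s" "majorized s N f" by (auto simp: majorizable_def)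
  then have "\<forall>\<^sub>F s in at_right 0. majorized s N f"
    unfolding eventually_at_right_field using majorized_shrink less_imp_le by (intro exI[of _ s]) blast
  then show ?thesis by (rule that)
qed

lemma majorizable_small:
  assumes "majorizable f" "f 0 = 0" "0 < \<epsilon>"
  shows "\<forall>\<^sub>F s in at_right 0. majorized s \<epsilon> f"
proof -
  from assms obtain t N where t: "0 < t" "majorized t N f" by (auto simp: majorizable_def)
  \<comment> \<open>Chosen so that \<open>r / t * N \<le> \<epsilon>\<close> for all positive
    \<open>r < s\<close>; \<open>N + 1\<close> avoids dividing by zero.\<close>
  define s where "s = min t (\<epsilon> * t / (N + 1))"
  have N: "0 \<le> N" using majorized_nonneg t by force
  have "majorized r \<epsilon> f" if "0 < r" "r < s" for r
  proof (rule majorized_mono)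
    show "majorized r (r / t * N) f"
      using that t assms by (intro majorized_shrink_0) (auto simp: s_def)
    have "r * N \<le> r * (N + 1)" using that by simp
    also have "r * (N + 1) \<le> \<epsilon> * t" using that N by (simp add: s_def field_simps)
    finally show "r / t * N \<le> \<epsilon>" using t by (simp add: field_simps)
  qed
  moreover have "0 < s" using t N assms by (simp add: s_def)
  ultimately show ?thesis
    unfolding eventually_at_right_field by blast
qed

lemma majorizable_add: "majorizable f \<Longrightarrow> majorizable g \<Longrightarrow> majorizable (\<lambda>x. f x + g x)"
proof -
  assume "majorizable f" "majorizable g"
  then obtain N M where "\<forall>\<^sub>F s in at_right 0. majorized s N f" "\<forall>\<^sub>F s in at_right 0. majorized s M g"
    by (metis majorizable_at_right)
  then have "\<forall>\<^sub>F s in at_right 0. majorized s N f \<and> majorized s M g" by eventually_elim auto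
  then obtain s where "0 < s" "majorized s N f" "majorized s M g"
    by (rule eventually_at_right_witness) auto
  then show ?thesis unfolding majorizable_def using majorized_add by blast
qed

lemma majorizable_mult: "majorizable f \<Longrightarrow> majorizable g \<Longrightarrow> majorizable (\<lambda>x. f x * g x)"
proof -
  assume "majorizable f" "majorizable g"
  then obtain N M where "\<forall>\<^sub>F s in at_right 0. majorized s N f" "\<forall>\<^sub>F s in at_right 0. majorized s M g"
    by (metis majorizable_at_right)
  then have "\<forall>\<^sub>F s in at_right 0. majorized s N f \<and> majorized s M g" by eventually_elim auto
  then obtain s where "0 < s" "majorized s N f" "majorized s M g"
    by (rule eventually_at_right_witness) auto
  then show ?thesis unfolding majorizable_def using majorized_mult by blast
qed

lemma majorizable_const: "majorizable (\<lambda>x. c)"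
  unfolding majorizable_def using majorized_const[of 1 c "\<bar>c\<bar>"] zero_less_one by blast

lemma majorizable_sum:
  "finite K \<Longrightarrow> (\<And>k. k \<in> K \<Longrightarrow> majorizable (f k)) \<Longrightarrow> majorizable (\<lambda>x. \<Sum>k\<in>K. f k x)"
  by (induction K rule: finite_induct) (auto intro: majorizable_const majorizable_add)

lemma majorizable_coord: "i \<in> Basis \<Longrightarrow> majorizable (\<lambda>x. x \<bullet> i)"
  unfolding majorizable_def using majorized_coord[of 1 i] zero_less_one by blast

lemma majorizable_cong:
  assumes "majorizable f" "\<forall>\<^sub>F x in nhds 0. f x = g x"
  shows "majorizable g"
proof -
  obtain N where "\<forall>\<^sub>F s in at_right 0. majorized s N f" using assms(1) by (rule majorizable_at_right)
  then have "\<forall>\<^sub>F s in at_right 0. majorized s N g"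
    using eventually_cube_at_right[OF assms(2)] by eventually_elim (simp cong: majorized_cong)
  then show ?thesis by (rule eventually_at_right_witness) (auto simp: majorizable_def)
qed

section \<open>Analyticity in terms of majorized series, and its closure properties\<close>

lemma has_sum_finite_sum:
  fixes f :: "'j \<Rightarrow> 'k \<Rightarrow> 'c::topological_comm_monoid_add"
  assumes "\<And>j. j \<in> J \<Longrightarrow> (f j has_sum s j) A"
  shows "((\<lambda>k. \<Sum>j\<in>J. f j k) has_sum (\<Sum>j\<in>J. s j)) A"
proof -
  have "(\<lambda>F. \<Sum>k\<in>F. \<Sum>j\<in>J. f j k) = (\<lambda>F. \<Sum>j\<in>J. \<Sum>k\<in>F. f j k)"
    by (rule ext) (rule sum.swap)
  then show ?thesis using assms unfolding has_sum_def by (auto intro: tendsto_sum)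
qed

text \<open>Unconditional convergence of a real series is absolute, so evaluating at the corner of a
  cube inside the ball of convergence bounds the norm. Conversely, a common radius for the finitely
  many components lets their coefficients be assembled into vectors.\<close>

lemma real_analytic_at_iff_majorizable:
  fixes f :: "'a::euclidean_space \<Rightarrow> 'b::euclidean_space"
  shows "real_analytic_at f a \<longleftrightarrow> (\<forall>j\<in>Basis. majorizable (\<lambda>x. f (a + x) \<bullet> j))"
proof
  assume "real_analytic_at f a"
  then obtain C r where r: "0 < r" and C: "\<And>x. x \<in> ball a r \<Longrightarrow>
     ((\<lambda>\<alpha>. monomial (x - a) \<alpha> *\<^sub>R C \<alpha>) has_sum f x) multi_indices"
    unfolding real_analytic_at_def monomial_def by blast
  have "\<forall>\<^sub>F x in nhds (0::'a). x \<in> ball 0 r"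
    using r by (intro eventually_nhds_in_open) auto
  then obtain s where s: "0 < s" and sr: "\<And>x::'a. x \<in> cube s \<Longrightarrow> x \<in> ball 0 r"
    by (rule eventually_nhds_cube) blast
  show "\<forall>j\<in>Basis. majorizable (\<lambda>x. f (a + x) \<bullet> j)"
  proof
    fix j :: 'b assume j: "j \<in> Basis"
    have sum: "((\<lambda>\<alpha>. (C \<alpha> \<bullet> j) * monomial x \<alpha>) has_sum f (a + x) \<bullet> j) multi_indices" if "x \<in> cube s" for x
    proof -
      have "a + x \<in> ball a r" using sr[OF that] by (simp add: dist_norm)
      from has_sum_bounded_linear[OF bounded_linear_inner_left C[OF this], of j]
      show ?thesis by (simp add: mult.commute)
    qed
    let ?p = "s *\<^sub>R (\<Sum>Basis) :: 'a"
    have pi: "?p \<bullet> i = s" if "i \<in> Basis" for i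
      using that by (simp add: inner_sum_left_Basis)
    then have p: "?p \<in> cube s" using s by (simp add: cube_def)
    have "monomial ?p \<alpha> = s ^ deg \<alpha>" for \<alpha>
      by (simp add: monomial_def pi deg_def power_sum inner_sum_left_Basis)
    then have "(\<lambda>\<alpha>. (C \<alpha> \<bullet> j) * s ^ deg \<alpha>) summable_on multi_indices"
      using has_sum_imp_summable[OF sum[OF p]] by simp
    then have "(\<lambda>\<alpha>. norm ((C \<alpha> \<bullet> j) * s ^ deg \<alpha>)) summable_on multi_indices"
      by (subst (asm) summable_on_iff_abs_summable_on_real)
    then have "(\<lambda>\<alpha>. \<bar>C \<alpha> \<bullet> j\<bar> * s ^ deg \<alpha>) summable_on multi_indices"
      using s by (simp add: abs_mult)
    then have "majorized s (\<Sum>\<^sub>\<infinity>\<alpha>\<in>multi_indices. \<bar>C \<alpha> \<bullet> j\<bar> * s ^ deg \<alpha>) (\<lambda>x. f (a + x) \<bullet> j)"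
      unfolding majorized_def using sum has_sum_infsum
      by (intro exI[of _ "\<lambda>\<alpha>. C \<alpha> \<bullet> j"]) blast
    then show "majorizable (\<lambda>x. f (a + x) \<bullet> j)" using s by (auto simp: majorizable_def)
  qed
next
  assume f: "\<forall>j\<in>Basis. majorizable (\<lambda>x. f (a + x) \<bullet> j)"
  then have "\<forall>j\<in>Basis. \<exists>N. \<forall>\<^sub>F s in at_right 0. majorized s N (\<lambda>x. f (a + x) \<bullet> j)"
    by (metis majorizable_at_right)
  then obtain N where "\<forall>j\<in>Basis. \<forall>\<^sub>F s in at_right 0. majorized s (N j) (\<lambda>x. f (a + x) \<bullet> j)"
    unfolding bchoice_iff by blast
  then have "\<forall>\<^sub>F s in at_right 0. \<forall>j\<in>Basis. majorized s (N j) (\<lambda>x. f (a + x) \<bullet> j)"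
    by (intro eventually_ball_finite) auto
  then obtain s where s: "0 < s" "\<forall>j\<in>Basis. majorized s (N j) (\<lambda>x. f (a + x) \<bullet> j)"
    by (rule eventually_at_right_witness)
  then have "\<forall>j\<in>Basis. \<exists>C. \<forall>x\<in>cube s. ((\<lambda>\<alpha>. C \<alpha> * monomial x \<alpha>) has_sum f (a + x) \<bullet> j) multi_indices"
    unfolding majorized_def by blast
  then obtain C where C: "\<forall>j\<in>Basis. \<forall>x\<in>cube s. ((\<lambda>\<alpha>. C j \<alpha> * monomial x \<alpha>) has_sum f (a + x) \<bullet> j) multi_indices"
    unfolding bchoice_iff by blast
  show "real_analytic_at f a"
    unfolding real_analytic_at_def monomial_def[symmetric]
  proof (intro exI conjI ballI)
    show "0 < s" by fact
    fix x assume "x \<in> ball a s"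
    then have "x - a \<in> ball 0 s" by (simp add: dist_norm norm_minus_commute)
    then have "x - a \<in> cube s" using ball_subset_cube by blast
    with C have *: "((\<lambda>\<alpha>. C j \<alpha> * monomial (x - a) \<alpha>) has_sum f x \<bullet> j) multi_indices" if "j \<in> Basis" for j
      using that by fastforce
    have "((\<lambda>\<alpha>. \<Sum>j\<in>Basis. (C j \<alpha> * monomial (x - a) \<alpha>) *\<^sub>R j) has_sum (\<Sum>j\<in>Basis. (f x \<bullet> j) *\<^sub>R j)) multi_indices"
      by (intro has_sum_finite_sum has_sum_bounded_linear[OF bounded_linear_scaleR_left] *)
    then show "((\<lambda>\<alpha>. monomial (x - a) \<alpha> *\<^sub>R (\<Sum>j\<in>Basis. C j \<alpha> *\<^sub>R j)) has_sum f x) multi_indices"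
      by (simp add: euclidean_representation scaleR_sum_right mult.commute)
  qed
qed

lemma real_analytic_at_components:
  fixes f :: "'a::euclidean_space \<Rightarrow> 'b::euclidean_space"
  shows "real_analytic_at f a \<longleftrightarrow> (\<forall>j\<in>Basis. real_analytic_at (\<lambda>x. f x \<bullet> j) a)"
  by (simp add: real_analytic_at_iff_majorizable)

lemma real_analytic_at_real:
  "real_analytic_at (f::'a::euclidean_space \<Rightarrow> real) a \<longleftrightarrow> majorizable (\<lambda>x. f (a + x))"
  by (simp add: real_analytic_at_iff_majorizable)

lemma real_analytic_at_cong:
  fixes f g :: "'a::euclidean_space \<Rightarrow> 'b::euclidean_space"
  assumes "real_analytic_at f a" "\<forall>\<^sub>F x in nhds a. f x = g x"
  shows "real_analytic_at g a"
proof -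
  have "filterlim (\<lambda>x. a + x) (nhds a) (nhds 0)" by (auto intro!: tendsto_eq_intros filterlim_ident)
  then have "\<forall>\<^sub>F x in nhds 0. f (a + x) = g (a + x)"
    by (rule eventually_compose_filterlim[OF assms(2)])
  then have *: "\<forall>\<^sub>F x in nhds 0. f (a + x) \<bullet> j = g (a + x) \<bullet> j" for j
    by eventually_elim simp
  from assms(1) show ?thesis
    unfolding real_analytic_at_iff_majorizable by (auto intro: majorizable_cong[OF _ *])
qed

lemma real_analytic_at_add:
  fixes f g :: "'a::euclidean_space \<Rightarrow> 'b::euclidean_space"
  shows "real_analytic_at f a \<Longrightarrow> real_analytic_at g a \<Longrightarrow> real_analytic_at (\<lambda>x. f x + g x) a"
  by (simp add: real_analytic_at_iff_majorizable inner_add_left majorizable_add)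

lemma real_analytic_at_const: "real_analytic_at (\<lambda>x. c) a"
  by (simp add: real_analytic_at_iff_majorizable majorizable_const)

lemma real_analytic_at_linear:
  fixes f :: "'a::euclidean_space \<Rightarrow> 'b::euclidean_space"
  assumes "linear f" shows "real_analytic_at f a"
proof -
  have "f (a + x) \<bullet> j = f a \<bullet> j + (\<Sum>i\<in>Basis. (x \<bullet> i) * (f i \<bullet> j))" for x j
  proof -
    have "f x \<bullet> j = f (\<Sum>i\<in>Basis. (x \<bullet> i) *\<^sub>R i) \<bullet> j" by (simp add: euclidean_representation)
    also have "\<dots> = (\<Sum>i\<in>Basis. (x \<bullet> i) * (f i \<bullet> j))"
      using assms by (simp add: linear_sum linear_scale inner_sum_left)
    finally show ?thesis using assms by (simp add: linear_add inner_add_left)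
  qed
  then show ?thesis
    by (auto simp: real_analytic_at_iff_majorizable
        intro!: majorizable_add majorizable_sum majorizable_mult majorizable_const majorizable_coord)
qed

lemma real_analytic_at_mult:
  fixes f g :: "'a::euclidean_space \<Rightarrow> real"
  shows "real_analytic_at f a \<Longrightarrow> real_analytic_at g a \<Longrightarrow> real_analytic_at (\<lambda>x. f x * g x) a"
  by (simp add: real_analytic_at_real majorizable_mult)

text \<open>The inner map minus its value at \<open>a\<close> vanishes there, so on a small cube its
  components have norm at most the radius \<open>t\<close> at which \<open>g\<close> is majorized;
  then substitution applies.\<close>

lemma real_analytic_at_compose:
  fixes f :: "'a::euclidean_space \<Rightarrow> 'b::euclidean_space" and g :: "'b \<Rightarrow> 'c::euclidean_space"
  assumes f: "real_analytic_at f a" and g: "real_analytic_at g (f a)"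
  shows "real_analytic_at (\<lambda>x. g (f x)) a"
  unfolding real_analytic_at_iff_majorizable
proof
  fix k :: 'c assume "k \<in> Basis"
  then obtain t N where t: "0 < t" "majorized t N (\<lambda>y. g (f a + y) \<bullet> k)"
    using g by (auto simp: real_analytic_at_iff_majorizable majorizable_def)
  have "majorizable (\<lambda>x. (f (a + x) - f a) \<bullet> j)" if "j \<in> Basis" for j
    using majorizable_add[OF _ majorizable_const, of "\<lambda>x. f (a + x) \<bullet> j" "- (f a \<bullet> j)"] f that
    by (simp add: inner_diff_left real_analytic_at_iff_majorizable)
  then have "\<forall>\<^sub>F s in at_right 0. \<forall>j\<in>Basis. majorized s t (\<lambda>x. (f (a + x) - f a) \<bullet> j)"
    using t by (intro eventually_ball_finite ballI majorizable_small) auto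
  then obtain s where s: "0 < s" "\<forall>j\<in>Basis. majorized s t (\<lambda>x. (f (a + x) - f a) \<bullet> j)"
    by (rule eventually_at_right_witness)
  from majorized_compose[OF s(1) t, of "\<lambda>x. f (a + x) - f a"] s(2)
  have "majorized s N (\<lambda>x. g (f (a + x)) \<bullet> k)" by simp
  then show "majorizable (\<lambda>x. g (f (a + x)) \<bullet> k)"
    using s by (auto simp: majorizable_def)
qed

text \<open>Re-expansion at \<open>a + b\<close> is substitution of \<open>b + x\<close>: for
  \<open>b\<close> in the cube of radius \<open>s/2\<close>, its components have norm at most
  \<open>s/2 + s/2 = s\<close> at radius \<open>s/2\<close>.\<close>

lemma real_analytic_at_nearby:
  fixes f :: "'a::euclidean_space \<Rightarrow> 'b::euclidean_space"
  assumes f: "real_analytic_at f a"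
  shows "\<forall>\<^sub>F y in nhds a. real_analytic_at f y"
proof -
  from f have "\<forall>j\<in>Basis. \<exists>N. \<forall>\<^sub>F s in at_right 0. majorized s N (\<lambda>x. f (a + x) \<bullet> j)"
    unfolding real_analytic_at_iff_majorizable by (metis majorizable_at_right)
  then obtain N where "\<forall>j\<in>Basis. \<forall>\<^sub>F s in at_right 0. majorized s (N j) (\<lambda>x. f (a + x) \<bullet> j)"
    unfolding bchoice_iff by blast
  then have "\<forall>\<^sub>F s in at_right 0. \<forall>j\<in>Basis. majorized s (N j) (\<lambda>x. f (a + x) \<bullet> j)"
    by (intro eventually_ball_finite) auto
  then obtain s where s: "0 < s" "\<forall>j\<in>Basis. majorized s (N j) (\<lambda>x. f (a + x) \<bullet> j)"
    by (rule eventually_at_right_witness)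
  have "real_analytic_at f (a + b)" if b: "b \<in> cube (s/2)" for b
    unfolding real_analytic_at_iff_majorizable
  proof
    fix j :: 'b assume j: "j \<in> Basis"
    have "majorized (s/2) (N j) (\<lambda>x. f (a + (b + x)) \<bullet> j)"
    proof (rule majorized_compose[of _ s "N j" "\<lambda>x. f (a + x) \<bullet> j" "\<lambda>x. b + x"])
      fix i :: 'a assume i: "i \<in> Basis"
      have "majorized (s/2) (s/2 + s/2) (\<lambda>x. b \<bullet> i + x \<bullet> i)"
        using s i b by (intro majorized_add majorized_const majorized_coord) (auto simp: cube_def)
      then show "majorized (s/2) s (\<lambda>x. (b + x) \<bullet> i)" by (simp add: inner_add_left)
    qed (use s j in auto)
    then show "majorizable (\<lambda>x. f (a + b + x) \<bullet> j)"
      unfolding majorizable_def add.assoc using s half_gt_zero by blast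
  qed
  moreover have "\<forall>\<^sub>F b in nhds 0. (b::'a) \<in> cube (s/2)" using s by (intro cube_nhds) auto
  ultimately have ev: "\<forall>\<^sub>F b in nhds 0. real_analytic_at f (a + b)" by (auto elim: eventually_mono)
  have "filterlim (\<lambda>y. y - a) (nhds 0) (nhds a)" by (auto intro!: tendsto_eq_intros filterlim_ident)
  from eventually_compose_filterlim[OF ev this] show ?thesis by simp
qed

section \<open>Hadamard quotients, continuity and differentiability\<close>

lemma monomial_factor:
  assumes "k \<in> Basis" "\<beta> k \<noteq> 0"
  shows "monomial z \<beta> = (z \<bullet> k) * monomial z (\<beta>(k := \<beta> k - 1))"
    and "deg \<beta> = Suc (deg (\<beta>(k := \<beta> k - 1)))"
proof -
  obtain m where m: "\<beta> k = Suc m" using assms by (cases "\<beta> k") auto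
  have "(\<Prod>i\<in>Basis - {k}. (z \<bullet> i) ^ \<beta> i) = (\<Prod>i\<in>Basis - {k}. (z \<bullet> i) ^ (\<beta>(k := m)) i)"
    by (intro prod.cong) auto
  then show "monomial z \<beta> = (z \<bullet> k) * monomial z (\<beta>(k := \<beta> k - 1))"
    using assms(1) by (simp add: monomial_def prod.remove[of Basis k] m)
  have "(\<Sum>i\<in>Basis - {k}. \<beta> i) = (\<Sum>i\<in>Basis - {k}. (\<beta>(k := m)) i)"
    by (intro sum.cong) auto
  then show "deg \<beta> = Suc (deg (\<beta>(k := \<beta> k - 1)))"
    using assms(1) by (simp add: deg_def sum.remove[of Basis k] m)
qed

lemma Basis_prod_Pair: "i \<in> Basis \<Longrightarrow> (i, 0) \<in> Basis" "i \<in> Basis \<Longrightarrow> (0, i) \<in> Basis"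
  by (simp_all add: Basis_prod_def)

lemma cube_Pair: "(x, u) \<in> cube s \<longleftrightarrow> x \<in> cube s \<and> u \<in> cube s"
  by (simp add: cube_def Basis_prod_def ball_Un)

text \<open>Hadamard's lemma for power series: in \<open>f (x + u) - f x\<close> every monomial contains some
  coordinate of \<open>u\<close>, which is factored out.\<close>

lemma majorized_difference:
  fixes f :: "'a::euclidean_space \<Rightarrow> real"
  assumes s: "0 < s" and f: "majorized (2 * s) N f"
  obtains q where "\<And>i. i \<in> Basis \<Longrightarrow> majorized s (N / s) (q i)"
    and "\<And>x u. x \<in> cube s \<Longrightarrow> u \<in> cube s \<Longrightarrow> f (x + u) - f x = (\<Sum>i\<in>Basis. (u \<bullet> i) * q i (x, u))"
proof -
  \<comment> \<open>The pair \<open>(x, u)\<close> is treated as one point of the product space;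
    adding two coordinates of norm \<open>s\<close> uses up the radius \<open>2 * s\<close>.\<close>
  have "majorized s N (\<lambda>z::'a\<times>'a. f (fst z + snd z))"
  proof (rule majorized_compose[OF s _ f])
    fix j :: 'a assume "j \<in> Basis"
    then have "majorized s (s + s) (\<lambda>z::'a\<times>'a. z \<bullet> (j, 0) + z \<bullet> (0, j))"
      using s by (intro majorized_add majorized_coord) (auto simp: Basis_prod_Pair)
    then show "majorized s (2 * s) (\<lambda>z::'a\<times>'a. (fst z + snd z) \<bullet> j)"
      by (simp add: inner_prod_def inner_add_left)
  qed (use s in auto)
  then obtain C M where M: "M \<le> N" "((\<lambda>\<beta>. \<bar>C \<beta>\<bar> * s ^ deg \<beta>) has_sum M) multi_indices"
    and C: "\<And>z. z \<in> cube s \<Longrightarrow> ((\<lambda>\<beta>. C \<beta> * monomial z \<beta>) has_sum f (fst z + snd z)) (multi_indices :: ('a\<times>'a \<Rightarrow> nat) set)"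
    by (auto simp: majorized_def)
  \<comment> \<open>\<open>pure\<close> collects the exponents without any coordinate of
    \<open>u\<close>; their monomials sum to \<open>f x\<close>. Every other exponent is assigned by
    \<open>sel\<close> to a single coordinate of \<open>u\<close>, so the sets \<open>K i\<close>
    are disjoint and cover the rest.\<close>
  define pure where "pure = {\<beta> \<in> multi_indices :: ('a\<times>'a \<Rightarrow> nat) set. \<forall>j\<in>Basis. \<beta> (0, j) = 0}"
  define sel where "sel \<beta> = (SOME i. i \<in> Basis \<and> \<beta> (0::'a, i::'a) \<noteq> (0::nat))" for \<beta>
  define K where "K i = {\<beta> \<in> multi_indices - pure. sel \<beta> = i}" for i
  define a where "a i \<beta> = \<beta>((0::'a, i::'a) := \<beta> (0, i) - (1::nat))" for i \<beta>
  define q where "q i z = (\<Sum>\<^sub>\<infinity>\<beta>\<in>K i. C \<beta> * monomial z (a i \<beta>))" for i z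
  have sel: "sel \<beta> \<in> Basis \<and> \<beta> (0, sel \<beta>) \<noteq> 0" if "\<beta> \<in> multi_indices - pure" for \<beta>
    unfolding sel_def by (rule someI_ex) (use that in \<open>auto simp: pure_def\<close>)
  have fact: "monomial z \<beta> = (snd z \<bullet> i) * monomial z (a i \<beta>)" "deg \<beta> = Suc (deg (a i \<beta>))"
    if "i \<in> Basis" "\<beta> \<in> K i" for i \<beta> z
    using monomial_factor(1)[of "(0,i)" \<beta> z] monomial_factor(2)[of "(0,i)" \<beta>] sel[of \<beta>] that Basis_prod_Pair(2)[of i]
    unfolding a_def K_def by (auto simp: inner_prod_def)
  have Msub: "(\<lambda>\<beta>. \<bar>C \<beta>\<bar> * s ^ deg \<beta>) summable_on K i" for i
    by (rule summable_on_subset_banach[OF has_sum_imp_summable[OF M(2)]]) (auto simp: K_def)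
  \<comment> \<open>Removing one coordinate of \<open>u\<close> lowers the degree by one and costs a
    factor \<open>1 / s\<close>, whence the bound \<open>N / s\<close>.\<close>
  have dega: "\<bar>C \<beta>\<bar> * s ^ deg (a i \<beta>) = (\<bar>C \<beta>\<bar> * s ^ deg \<beta>) * (1 / s)" if "i \<in> Basis" "\<beta> \<in> K i" for i \<beta>
    using fact(2)[OF that] s by simp
  have "majorized s (N / s) (q i)" if i: "i \<in> Basis" for i
  proof (rule majorized_regroup[OF s, where K="K i" and c=C and a="a i"])
    have "((\<lambda>\<beta>. (\<bar>C \<beta>\<bar> * s ^ deg \<beta>) * (1 / s)) has_sum (\<Sum>\<^sub>\<infinity>\<beta>\<in>K i. \<bar>C \<beta>\<bar> * s ^ deg \<beta>) * (1 / s)) (K i)"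
      using Msub by (intro has_sum_cmult_left has_sum_infsum)
    then show "((\<lambda>\<beta>. \<bar>C \<beta>\<bar> * s ^ deg (a i \<beta>)) has_sum (\<Sum>\<^sub>\<infinity>\<beta>\<in>K i. \<bar>C \<beta>\<bar> * s ^ deg \<beta>) * (1 / s)) (K i)"
      using dega[OF i] by (simp cong: has_sum_cong)
    have "(\<Sum>\<^sub>\<infinity>\<beta>\<in>K i. \<bar>C \<beta>\<bar> * s ^ deg \<beta>) \<le> M"
      by (rule has_sum_mono2[OF has_sum_infsum[OF Msub] M(2)]) (use s in \<open>auto simp: K_def\<close>)
    then show "(\<Sum>\<^sub>\<infinity>\<beta>\<in>K i. \<bar>C \<beta>\<bar> * s ^ deg \<beta>) * (1 / s) \<le> N / s"
      using M(1) s by (simp add: divide_right_mono)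
    show "a i ` K i \<subseteq> multi_indices"
      using i Basis_prod_Pair(2)[of i] by (auto simp: K_def a_def PiE_def extensional_def)
  qed (simp add: q_def)
  moreover
  have "f (x + u) - f x = (\<Sum>i\<in>Basis. (u \<bullet> i) * q i (x, u))" if x: "x \<in> cube s" and u: "u \<in> cube s" for x u
  proof -
    have mem: "(x, u) \<in> cube s" "(x, 0) \<in> cube s"
      using x u s by (simp_all add: cube_Pair zero_in_cube)
    have m0: "monomial (x, 0) \<beta> = monomial (x, u) \<beta>" if "\<beta> \<in> pure" for \<beta>
      unfolding monomial_def using that by (intro prod.cong) (auto simp: pure_def Basis_prod_def inner_prod_def)
    have m1: "monomial (x, 0) \<beta> = 0" if "\<beta> \<in> multi_indices - pure" for \<beta>
      using sel[OF that] monomial_factor(1)[of "(0, sel \<beta>)" \<beta> "(x,0)"] Basis_prod_Pair(2)[of "sel \<beta>"]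
      by (simp add: inner_prod_def)
    \<comment> \<open>Setting \<open>u = 0\<close> annihilates all other monomials and leaves the
      pure ones unchanged, which isolates \<open>f x\<close>.\<close>
    have "((\<lambda>\<beta>. C \<beta> * monomial (x, 0) \<beta>) has_sum f x) multi_indices"
      using C[OF mem(2)] by simp
    then have pure: "((\<lambda>\<beta>. C \<beta> * monomial (x, u) \<beta>) has_sum f x) pure"
      by (rule iffD1[OF has_sum_cong_neutral, rotated -1]) (use m0 m1 in \<open>auto simp: pure_def\<close>)
    have all: "((\<lambda>\<beta>. C \<beta> * monomial (x, u) \<beta>) has_sum f (x + u)) multi_indices"
      using C[OF mem(1)] by simp
    have Ki: "((\<lambda>\<beta>. C \<beta> * monomial (x, u) \<beta>) has_sum (u \<bullet> i) * q i (x, u)) (K i)" if i: "i \<in> Basis" for i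
    proof -
      have "(\<lambda>\<beta>. \<bar>C \<beta>\<bar> * s ^ deg (a i \<beta>)) summable_on K i"
        by (rule iffD2[OF summable_on_cong[OF dega[OF i]] summable_on_cmult_left[OF Msub]])
      then have "(\<lambda>\<beta>. norm (C \<beta> * monomial (x, u) (a i \<beta>))) summable_on K i"
        by (rule summable_on_comparison_test)
          (use abs_monomial_le[OF mem(1)] in \<open>auto simp: abs_mult intro!: mult_left_mono\<close>)
      then have "(\<lambda>\<beta>. C \<beta> * monomial (x, u) (a i \<beta>)) summable_on K i"
        by (rule abs_summable_summable)
      then have "((\<lambda>\<beta>. C \<beta> * monomial (x, u) (a i \<beta>)) has_sum q i (x, u)) (K i)"
        unfolding q_def by (rule has_sum_infsum)
      then have "((\<lambda>\<beta>. (u \<bullet> i) * (C \<beta> * monomial (x, u) (a i \<beta>))) has_sum (u \<bullet> i) * q i (x, u)) (K i)"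
        by (rule has_sum_cmult_right)
      then show ?thesis using fact(1)[OF i, of _ "(x,u)"] by (simp add: mult_ac cong: has_sum_cong)
    qed
    have "((\<lambda>\<beta>. C \<beta> * monomial (x, u) \<beta>) has_sum (\<Sum>i\<in>Basis. (u \<bullet> i) * q i (x, u))) (\<Union>i\<in>Basis. K i)"
      by (rule sum_has_sum) (use Ki in \<open>auto simp: K_def\<close>)
    moreover have "(\<Union>i\<in>Basis. K i) = multi_indices - pure" using sel by (auto simp: K_def)
    ultimately have "((\<lambda>\<beta>. C \<beta> * monomial (x, u) \<beta>) has_sum f x + (\<Sum>i\<in>Basis. (u \<bullet> i) * q i (x, u))) (pure \<union> (multi_indices - pure))"
      using pure by (intro has_sum_Un_disjoint) auto
    moreover have "pure \<union> (multi_indices - pure) = multi_indices" by (auto simp: pure_def)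
    ultimately show ?thesis using all has_sum_unique by fastforce
  qed
  ultimately show ?thesis by (rule that)
qed

lemma real_analytic_at_difference:
  fixes f :: "'a::euclidean_space \<Rightarrow> real"
  assumes "real_analytic_at f a"
  obtains q where "\<And>i. i \<in> Basis \<Longrightarrow> real_analytic_at (q i) (a, 0)"
    and "\<forall>\<^sub>F (x, u) in nhds (a, 0). f (x + u) - f x = (\<Sum>i\<in>Basis. (u \<bullet> i) * q i (x, u))"
proof -
  obtain t N where t: "0 < t" "majorized t N (\<lambda>x. f (a + x))"
    using assms by (auto simp: real_analytic_at_real majorizable_def)
  define s where "s = t / 2"
  have s: "0 < s" "majorized (2 * s) N (\<lambda>x. f (a + x))" using t by (auto simp: s_def)
  obtain q where q: "\<And>i. i \<in> Basis \<Longrightarrow> majorized s (N / s) (q i)"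
    and fq: "\<And>x u. x \<in> cube s \<Longrightarrow> u \<in> cube s \<Longrightarrow> f (a + (x + u)) - f (a + x) = (\<Sum>i\<in>Basis. (u \<bullet> i) * q i (x, u))"
    using majorized_difference[OF s] by blast
  show ?thesis
  proof (rule that[of "\<lambda>i z. q i (z - (a, 0))"])
    show "real_analytic_at (\<lambda>z. q i (z - (a, 0))) (a, 0)" if "i \<in> Basis" for i
      using q[OF that] s by (auto simp: real_analytic_at_real majorizable_def)
    have "filterlim (\<lambda>z. z - (a, 0::'a)) (nhds 0) (nhds (a, 0))"
      using tendsto_diff[OF filterlim_ident tendsto_const, of "(a, 0::'a)" "(a, 0)"] by simp
    from eventually_compose_filterlim[OF cube_nhds[OF s(1)] this]
    have "\<forall>\<^sub>F z in nhds (a, 0). z - (a, 0::'a) \<in> cube s" .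
    then show "\<forall>\<^sub>F (x, u) in nhds (a, 0). f (x + u) - f x = (\<Sum>i\<in>Basis. (u \<bullet> i) * q i ((x, u) - (a, 0)))"
    proof eventually_elim
      case (elim z)
      obtain x u where z: "z = (x, u)" by fastforce
      with elim have "(x - a, u) \<in> cube s" by simp
      then have "x - a \<in> cube s" "u \<in> cube s"
        by (simp_all add: cube_Pair)
      from fq[OF this] show ?case by (simp add: z add_ac)
    qed
  qed
qed

lemma isCont_real_analytic_at_real:
  fixes f :: "'a::euclidean_space \<Rightarrow> real"
  assumes "real_analytic_at f a" shows "isCont f a"
proof -
  have f: "majorizable (\<lambda>x. f (a + x) - f a)"
    using majorizable_add[OF _ majorizable_const, of "\<lambda>x. f (a + x)" "- f a"] assms
    by (simp add: real_analytic_at_real)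
  have "\<forall>\<^sub>F x in nhds 0. \<bar>f (a + x) - f a\<bar> < e" if e: "0 < e" for e
  proof -
    obtain s where s: "0 < s" "majorized s (e/2) (\<lambda>x. f (a + x) - f a)"
      using majorizable_small[OF f, of "e/2"] e eventually_at_right_witness by auto
    show ?thesis
      using cube_nhds[OF s(1)] by eventually_elim (use majorized_abs_le[OF s(2)] e in fastforce)
  qed
  then have "((\<lambda>x. f (a + x)) \<longlongrightarrow> f a) (nhds 0)"
    by (simp add: tendsto_iff dist_real_def)
  then have "((\<lambda>x. f (a + x)) \<longlongrightarrow> f a) (at 0)"
    by (rule tendsto_mono[rotated]) (simp add: at_within_def)
  then show ?thesis by (simp add: isCont_def LIM_offset_zero_iff)
qed

lemma isCont_real_analytic_at:
  fixes f :: "'a::euclidean_space \<Rightarrow> 'b::euclidean_space"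
  assumes "real_analytic_at f a" shows "isCont f a"
proof -
  have "isCont (\<lambda>x. f x \<bullet> j) a" if "j \<in> Basis" for j
    using assms that isCont_real_analytic_at_real real_analytic_at_components by blast
  then have "isCont (\<lambda>x. \<Sum>j\<in>Basis. (f x \<bullet> j) *\<^sub>R j) a"
    by (intro continuous_sum continuous_scaleR continuous_const)
  then show ?thesis by (simp add: euclidean_representation)
qed

text \<open>The remainder is the sum of \<open>u \<bullet> i\<close> times
  \<open>q i (x, u) - q i (x, 0)\<close>; the first factor is at most \<open>norm u\<close> in
  absolute value and the second tends to zero by continuity. The derivative is obtained at all
  points near \<open>a\<close>, so that it can be differentiated again.\<close>

lemma has_derivative_difference_quotients:
  fixes f :: "'a::euclidean_space \<Rightarrow> real"
  assumes q: "\<And>i. i \<in> Basis \<Longrightarrow> real_analytic_at (q i) (a, 0)"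
    and fq: "\<forall>\<^sub>F (x, u) in nhds (a, 0). f (x + u) - f x = (\<Sum>i\<in>Basis. (u \<bullet> i) * q i (x, u))"
  shows "\<forall>\<^sub>F x in nhds a. (f has_derivative (\<lambda>u. \<Sum>i\<in>Basis. (u \<bullet> i) * q i (x, 0))) (at x)"
proof -
  have pair: "((\<lambda>x. (x, 0::'a)) \<longlongrightarrow> (a, 0)) (nhds a)"
    by (auto intro!: tendsto_intros filterlim_ident)
  have "\<forall>\<^sub>F z in nhds (a, 0). \<forall>i\<in>Basis. isCont (q i) z"
    by (intro eventually_ball_finite ballI eventually_mono[OF real_analytic_at_nearby[OF q]]
        isCont_real_analytic_at_real) auto
  then have ev1: "\<forall>\<^sub>F x in nhds a. \<forall>i\<in>Basis. isCont (q i) (x, 0)"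
    by (rule eventually_compose_filterlim[OF _ pair])
  \<comment> \<open>An open set around \<open>(a, 0)\<close> is a neighbourhood of
    \<open>(x, 0)\<close> for every \<open>x\<close> near \<open>a\<close>, hence the iterated
    eventuality.\<close>
  have ev2: "\<forall>\<^sub>F x in nhds a. \<forall>\<^sub>F (x, u) in nhds (x, 0). f (x + u) - f x = (\<Sum>i\<in>Basis. (u \<bullet> i) * q i (x, u))"
    using fq by (subst (asm) eventually_eventually[symmetric]) (rule eventually_compose_filterlim[OF _ pair])
  from ev1 ev2 show ?thesis
  proof eventually_elim
    case (elim x)
    have t: "((\<lambda>u. (x, u)) \<longlongrightarrow> (x, 0)) (nhds (0::'a))"
      by (auto intro!: tendsto_intros filterlim_ident)
    have t': "((\<lambda>u. (x, u)) \<longlongrightarrow> (x, 0)) (at (0::'a))"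
      by (auto intro!: tendsto_intros)
    have "\<forall>\<^sub>F u in nhds 0. f (x + u) - f x = (\<Sum>i\<in>Basis. (u \<bullet> i) * q i (x, u))"
      using eventually_compose_filterlim[OF elim(2) t] by simp
    then have ev: "\<forall>\<^sub>F u in at 0. f (x + u) - f x = (\<Sum>i\<in>Basis. (u \<bullet> i) * q i (x, u))"
      by (auto simp: eventually_at_filter elim: eventually_mono)
    have qt: "((\<lambda>u. q i (x, u) - q i (x, 0)) \<longlongrightarrow> 0) (at 0)" if "i \<in> Basis" for i
      using isCont_tendsto_compose[OF elim(1)[rule_format, OF that] t'] by (rule LIM_zero)
    have "((\<lambda>u. \<Sum>i\<in>Basis. (u \<bullet> i) / norm u * (q i (x, u) - q i (x, 0))) \<longlongrightarrow> 0) (at 0)"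
    proof (rule tendsto_null_sum)
      fix i :: 'a assume i: "i \<in> Basis"
      have "\<bar>u \<bullet> i\<bar> / norm u \<le> 1" for u
        using Basis_le_norm[OF i, of u] by (cases "u = 0") (auto simp: divide_simps)
      then have "Bfun (\<lambda>u. (u \<bullet> i) / norm u) (at 0)"
        by (intro BfunI[of _ 1] always_eventually) (simp add: abs_mult)
      moreover have "Zfun (\<lambda>u. q i (x, u) - q i (x, 0)) (at 0)"
        using qt[OF i] by (simp add: tendsto_Zfun_iff)
      ultimately show "((\<lambda>u. (u \<bullet> i) / norm u * (q i (x, u) - q i (x, 0))) \<longlongrightarrow> 0) (at 0)"
        using bounded_bilinear.Bfun_prod_Zfun[OF bounded_bilinear_mult] by (simp add: tendsto_Zfun_iff del: times_divide_eq_left)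
    qed
    then have "((\<lambda>u. norm (f (x + u) - f x - (\<Sum>i\<in>Basis. (u \<bullet> i) * q i (x, 0))) / norm u) \<longlongrightarrow> 0) (at 0)"
    proof (subst tendsto_cong)
      show "\<forall>\<^sub>F u in at 0. norm (f (x + u) - f x - (\<Sum>i\<in>Basis. (u \<bullet> i) * q i (x, 0))) / norm u =
          norm (\<Sum>i\<in>Basis. (u \<bullet> i) / norm u * (q i (x, u) - q i (x, 0)))"
        using ev
      proof eventually_elim
        case (elim u)
        have "f (x + u) - f x - (\<Sum>i\<in>Basis. (u \<bullet> i) * q i (x, 0)) =
            (\<Sum>i\<in>Basis. (u \<bullet> i) * (q i (x, u) - q i (x, 0)))"
          by (simp add: elim sum_subtractf right_diff_distrib)
        moreover have "(\<Sum>i\<in>Basis. (u \<bullet> i) / norm u * (q i (x, u) - q i (x, 0))) =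
           (\<Sum>i\<in>Basis. (u \<bullet> i) * (q i (x, u) - q i (x, 0))) / norm u"
          by (simp add: sum_divide_distrib)
        ultimately show ?case by simp
      qed
    qed (rule tendsto_norm_zero)
    moreover have "bounded_linear (\<lambda>u. \<Sum>i\<in>Basis. (u \<bullet> i) * q i (x, 0))"
      by (intro bounded_linear_sum bounded_linear_mult_left[THEN bounded_linear_compose] bounded_linear_inner_left)
    ultimately show ?case by (simp add: has_derivative_at)
  qed
qed

text \<open>The partial derivatives are the Hadamard quotients at \<open>u = 0\<close>, analytic as
  composites with the linear map sending \<open>x\<close> to \<open>(x, 0)\<close>.\<close>

lemma real_analytic_at_derivative:
  fixes f :: "'a::euclidean_space \<Rightarrow> real"
  assumes "real_analytic_at f a"
  obtains g where "\<And>i. i \<in> Basis \<Longrightarrow> real_analytic_at (g i) a"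
    and "\<forall>\<^sub>F x in nhds a. (f has_derivative (\<lambda>u. \<Sum>i\<in>Basis. (u \<bullet> i) * g i x)) (at x)"
proof -
  obtain q where q: "\<And>i. i \<in> Basis \<Longrightarrow> real_analytic_at (q i) (a, 0)"
    and fq: "\<forall>\<^sub>F (x, u) in nhds (a, 0). f (x + u) - f x = (\<Sum>i\<in>Basis. (u \<bullet> i) * q i (x, u))"
    using real_analytic_at_difference[OF assms] by blast
  have aff: "real_analytic_at (\<lambda>x::'a. (x, 0::'a)) a"
    by (intro real_analytic_at_linear linearI) auto
  show ?thesis
  proof (rule that[of "\<lambda>i x. q i (x, 0)"])
    show "real_analytic_at (\<lambda>x. q i (x, 0)) a" if "i \<in> Basis" for i
      using real_analytic_at_compose[OF aff, of "q i"] q[OF that] by simp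
  qed (rule has_derivative_difference_quotients[OF q fq])
qed

lemma tendsto_nhds_real_analytic_at:
  fixes f :: "'a::euclidean_space \<Rightarrow> 'b::euclidean_space"
  assumes "real_analytic_at f a" shows "(f \<longlongrightarrow> f a) (nhds a)"
  using isCont_real_analytic_at[OF assms] by (simp add: isCont_def tendsto_at_iff_tendsto_nhds)

section \<open>The analytic inverse function theorem\<close>

text \<open>Picard iteration \<open>h (Suc n) y = y - R (h n y)\<close>: the differences of consecutive iterates are
  halved in each step, measured by their power series bounds, so the limit is again a power series.\<close>

lemma real_analytic_near_identity_inverse:
  fixes R :: "'a::euclidean_space \<Rightarrow> 'a"
  assumes R: "real_analytic_at R 0" "R 0 = 0" "(R has_derivative (\<lambda>_. 0)) (at 0)"
  obtains \<Psi> where "real_analytic_at \<Psi> 0" "\<Psi> 0 = 0"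
    "\<forall>\<^sub>F y in nhds 0. \<Psi> y + R (\<Psi> y) = y" "\<forall>\<^sub>F x in nhds 0. \<Psi> (x + R x) = x"
proof -
  have "\<forall>j\<in>Basis. \<exists>q. (\<forall>i\<in>Basis. real_analytic_at (q i) (0::'a, 0::'a)) \<and>
     (\<forall>\<^sub>F (x, u) in nhds (0, 0). R (x + u) \<bullet> j - R x \<bullet> j = (\<Sum>i\<in>Basis. (u \<bullet> i) * q i (x, u)))"
  proof
    fix j :: 'a assume "j \<in> Basis"
    then have "real_analytic_at (\<lambda>x. R x \<bullet> j) 0" using R(1) real_analytic_at_components by blast
    then show "\<exists>q. (\<forall>i\<in>Basis. real_analytic_at (q i) (0::'a, 0::'a)) \<and>
     (\<forall>\<^sub>F (x, u) in nhds (0, 0). R (x + u) \<bullet> j - R x \<bullet> j = (\<Sum>i\<in>Basis. (u \<bullet> i) * q i (x, u)))"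
      by (rule real_analytic_at_difference) blast
  qed
  then obtain q where "\<forall>j\<in>Basis. (\<forall>i\<in>Basis. real_analytic_at (q j i) (0::'a, 0::'a)) \<and>
     (\<forall>\<^sub>F (x, u) in nhds (0, 0). R (x + u) \<bullet> j - R x \<bullet> j = (\<Sum>i\<in>Basis. (u \<bullet> i) * q j i (x, u)))"
    unfolding bchoice_iff by blast
  then have q: "\<And>j i. j \<in> Basis \<Longrightarrow> i \<in> Basis \<Longrightarrow> real_analytic_at (q j i) (0::'a, 0::'a)"
    and Rq: "\<And>j. j \<in> Basis \<Longrightarrow> \<forall>\<^sub>F (x, u) in nhds (0, 0). R (x + u) \<bullet> j - R x \<bullet> j = (\<Sum>i\<in>Basis. (u \<bullet> i) * q j i (x, u))"
    by blast+
  \<comment> \<open>The vanishing differential of \<open>R\<close> forces the quotients to vanish at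
    the origin, so \<open>majorizable_small\<close> makes them as small as desired.\<close>
  have q0: "q j i (0, 0) = 0" if ji: "j \<in> Basis" "i \<in> Basis" for i j
  proof -
    have "((\<lambda>x. R x \<bullet> j) has_derivative (\<lambda>u. \<Sum>i\<in>Basis. (u \<bullet> i) * q j i (0, 0))) (at 0)"
      using has_derivative_difference_quotients[OF q Rq] ji eventually_nhds_x_imp_x by blast
    moreover have "((\<lambda>x. R x \<bullet> j) has_derivative (\<lambda>u. 0)) (at 0)"
      using has_derivative_inner_left[OF R(3), of j] by simp
    ultimately have "(\<lambda>u. \<Sum>i\<in>Basis. (u \<bullet> i) * q j i (0, 0)) = (\<lambda>u. 0)"
      by (rule has_derivative_unique)
    from fun_cong[OF this, of i] ji(2) show ?thesis
      by (simp add: inner_Basis if_distrib[of "\<lambda>c. c * _"] cong: if_cong)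
  qed
  \<comment> \<open>The quotient bound \<open>\<epsilon>\<close>, summed over all basis directions,
    gives the contraction factor \<open>1 / 2\<close>.\<close>
  define \<epsilon> where "\<epsilon> = 1 / (2 * real DIM('a))"
  have \<epsilon>: "0 < \<epsilon>" "real DIM('a) * \<epsilon> = 1 / 2" by (simp_all add: \<epsilon>_def)
  have "\<forall>\<^sub>F \<rho> in at_right 0. \<forall>j\<in>Basis. \<forall>i\<in>Basis. majorized \<rho> \<epsilon> (q j i)"
    using q q0 \<epsilon>(1)
    by (intro eventually_ball_finite ballI majorizable_small)
      (simp_all add: real_analytic_at_real flip: zero_prod_def)
  moreover have Rq': "\<forall>\<^sub>F z in nhds 0. \<forall>j\<in>Basis. R (fst z + snd z) \<bullet> j - R (fst z) \<bullet> j =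
      (\<Sum>i\<in>Basis. (snd z \<bullet> i) * q j i z)"
    using Rq by (intro eventually_ball_finite ballI) (auto simp: case_prod_unfold zero_prod_def)
  from eventually_cube_at_right[OF this]
  have "\<forall>\<^sub>F \<rho> in at_right 0. \<forall>z\<in>cube \<rho>. \<forall>j\<in>Basis. R (fst z + snd z) \<bullet> j - R (fst z) \<bullet> j =
      (\<Sum>i\<in>Basis. (snd z \<bullet> i) * q j i z)" .
  moreover have "\<forall>\<^sub>F x in nhds 0. isCont R x"
    by (rule eventually_mono[OF real_analytic_at_nearby[OF R(1)]]) (rule isCont_real_analytic_at)
  from eventually_cube_at_right[OF this]
  have "\<forall>\<^sub>F \<rho> in at_right 0. \<forall>x\<in>cube \<rho>. isCont R x" .
  ultimately have "\<forall>\<^sub>F \<rho> in at_right 0. (\<forall>j\<in>Basis. \<forall>i\<in>Basis. majorized \<rho> \<epsilon> (q j i)) \<and>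
    (\<forall>z\<in>cube \<rho>. \<forall>j\<in>Basis. R (fst z + snd z) \<bullet> j - R (fst z) \<bullet> j = (\<Sum>i\<in>Basis. (snd z \<bullet> i) * q j i z)) \<and>
    (\<forall>x\<in>cube \<rho>. isCont R x)"
    by eventually_elim blast
  then obtain \<rho> where \<rho>: "0 < \<rho>" and mq: "\<And>j i. j \<in> Basis \<Longrightarrow> i \<in> Basis \<Longrightarrow> majorized \<rho> \<epsilon> (q j i)"
    and diff: "\<And>x u j. (x, u) \<in> cube \<rho> \<Longrightarrow> j \<in> Basis \<Longrightarrow> R (x + u) \<bullet> j - R x \<bullet> j = (\<Sum>i\<in>Basis. (u \<bullet> i) * q j i (x, u))"
    and cont: "\<And>x. x \<in> cube \<rho> \<Longrightarrow> isCont R x"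
    by (rule eventually_at_right_witness) fastforce
  \<comment> \<open>At radius \<open>\<sigma>\<close> the increments have norms at most
    \<open>\<sigma>\<close>, \<open>\<sigma> / 2\<close>, \<open>\<sigma> / 4\<close> and so on,
    adding up to \<open>2 * \<sigma> = \<rho>\<close>; so all iterates stay where the quotient
    identity holds.\<close>
  define \<sigma> where "\<sigma> = \<rho> / 2"
  have \<sigma>: "0 < \<sigma>" "\<rho> = 2 * \<sigma>" using \<rho> by (simp_all add: \<sigma>_def)
  define h where "h n = ((\<lambda>\<phi> y. y - R (\<phi> y)) ^^ n) (\<lambda>y. 0)" for n
  have h0: "h 0 y = 0" and hSuc: "h (Suc n) y = y - R (h n y)" for n y
    by (simp_all add: h_def)
  define d where "d n y = h (Suc n) y - h n y" for n y
  have hSuc': "h (Suc n) y = h n y + d n y" for n y by (simp add: d_def)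
  have step: "(\<forall>j\<in>Basis. majorized \<sigma> (\<sigma> / 2 ^ n) (\<lambda>y. d n y \<bullet> j)) \<and>
      (\<forall>j\<in>Basis. majorized \<sigma> (2 * \<sigma> * (1 - 1 / 2 ^ n)) (\<lambda>y. h n y \<bullet> j))" for n
  proof (induction n)
    case 0
    show ?case
      using \<sigma> R(2) by (auto simp: d_def h0 hSuc intro!: majorized_coord majorized_const)
  next
    case (Suc n)
    have H: "majorized \<sigma> (2 * \<sigma> * (1 - 1 / 2 ^ n) + \<sigma> / 2 ^ n) (\<lambda>y. h n y \<bullet> j + d n y \<bullet> j)" if "j \<in> Basis" for j
      using Suc that \<sigma> by (intro majorized_add) auto
    have *: "2 * \<sigma> * (1 - 1 / 2 ^ n) + \<sigma> / 2 ^ n = 2 * \<sigma> * (1 - 1 / 2 ^ Suc n)"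
      by (simp add: field_simps)
    have pair: "majorized \<sigma> \<rho> (\<lambda>y. (h n y, d n y) \<bullet> k)" if k: "k \<in> Basis" for k
    proof -
      have "\<sigma> / 2 ^ n \<le> \<sigma> / 1" using \<sigma>(1) by (intro divide_left_mono) auto
      moreover have "2 * \<sigma> * (1 - 1 / 2 ^ n) \<le> 2 * \<sigma> * 1" using \<sigma>(1) by (intro mult_left_mono) auto
      ultimately have le: "\<sigma> / 2 ^ n \<le> \<rho>" "2 * \<sigma> * (1 - 1 / 2 ^ n) \<le> \<rho>"
        using \<sigma> by linarith+
      consider j where "j \<in> Basis" "k = (j, 0)" | j where "j \<in> Basis" "k = (0, j)"
        using k by (auto simp: Basis_prod_def)
      then show ?thesis
        using Suc le by cases (auto intro: majorized_mono)
    qed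
    \<comment> \<open>The new increment is \<open>- (R (h n y + d n y) - R (h n y))\<close>, which
      the quotient identity expresses through \<open>d n y\<close>.\<close>
    have "majorized \<sigma> (\<sigma> / 2 ^ Suc n) (\<lambda>y. d (Suc n) y \<bullet> j)" if j: "j \<in> Basis" for j
    proof -
      have "majorized \<sigma> (\<Sum>i\<in>(Basis::'a set). (\<sigma> / 2 ^ n) * \<epsilon>) (\<lambda>y. \<Sum>i\<in>Basis. (d n y \<bullet> i) * q j i (h n y, d n y))"
        using Suc j \<sigma> pair by (intro majorized_sum majorized_mult majorized_compose[OF _ \<rho> mq]) auto
      moreover have "(\<Sum>i\<in>(Basis::'a set). (\<sigma> / 2 ^ n) * \<epsilon>) = (real DIM('a) * \<epsilon>) * (\<sigma> / 2 ^ n)"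
        by simp
      then have "(\<Sum>i\<in>(Basis::'a set). (\<sigma> / 2 ^ n) * \<epsilon>) = \<sigma> / 2 ^ Suc n"
        unfolding \<epsilon>(2) by simp
      ultimately have "majorized \<sigma> (\<sigma> / 2 ^ Suc n) (\<lambda>y. - (\<Sum>i\<in>Basis. (d n y \<bullet> i) * q j i (h n y, d n y)))"
        using \<sigma> by (simp only: majorized_uminus)
      moreover have "- (\<Sum>i\<in>Basis. (d n y \<bullet> i) * q j i (h n y, d n y)) = d (Suc n) y \<bullet> j" if y: "y \<in> cube \<sigma>" for y
      proof -
        have "(h n y, d n y) \<in> cube \<rho>"
          unfolding cube_def using majorized_abs_le[OF pair y] by auto
        moreover have "d (Suc n) y = R (h n y) - R (h n y + d n y)"
          unfolding hSuc'[symmetric] by (simp add: d_def hSuc)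
        ultimately show ?thesis using diff[of "h n y" "d n y" j] j by (simp add: inner_diff_left)
      qed
      ultimately show ?thesis by (rule iffD1[OF majorized_cong, rotated])
    qed
    with H show ?case unfolding * hSuc' inner_add_left by blast
  qed
  \<comment> \<open>The limit of the iterates, written as a sum of increments so that its components
    are majorized.\<close>
  define \<Psi> where "\<Psi> y = (\<Sum>j\<in>Basis. (\<Sum>\<^sub>\<infinity>n. d n y \<bullet> j) *\<^sub>R j)" for y
  have \<Psi>j: "\<Psi> y \<bullet> j = (\<Sum>\<^sub>\<infinity>n. d n y \<bullet> j)" if "j \<in> Basis" for y j
    using that by (simp add: \<Psi>_def)
  have geo: "((\<lambda>n. \<sigma> / 2 ^ n) has_sum \<rho>) UNIV"
  proof (rule norm_summable_imp_has_sum)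
    have "(\<lambda>n. \<sigma> * (1 / 2) ^ n) sums (\<sigma> * (1 / (1 - 1 / 2)))"
      by (intro sums_mult geometric_sums) simp
    then show "(\<lambda>n. \<sigma> / 2 ^ n) sums \<rho>" by (simp add: \<sigma>(2) power_divide mult.commute)
    then show "summable (\<lambda>n. norm (\<sigma> / 2 ^ n))"
      using \<sigma> by (simp add: sums_iff)
  qed
  have m\<Psi>: "majorized \<sigma> \<rho> (\<lambda>y. \<Psi> y \<bullet> j)" if "j \<in> Basis" for j
    by (rule majorized_infsum[OF \<sigma>(1) _ geo \<Psi>j]) (use step that in auto)
  have fixed: "\<Psi> y + R (\<Psi> y) = y" if y: "y \<in> cube \<sigma>" for y
  proof -
    have hj: "(\<lambda>n. h n y \<bullet> j) \<longlonglongrightarrow> \<Psi> y \<bullet> j" if j: "j \<in> Basis" for j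
    proof -
      have "(\<lambda>n. norm (d n y \<bullet> j)) summable_on UNIV"
        by (rule summable_on_comparison_test[OF has_sum_imp_summable[OF geo]])
          (use majorized_abs_le[OF _ y] step j in auto)
      then have "(\<lambda>n. d n y \<bullet> j) summable_on UNIV" by (rule abs_summable_summable)
      then have "(\<lambda>n. d n y \<bullet> j) sums (\<Psi> y \<bullet> j)"
        unfolding \<Psi>j[OF j] by (intro has_sum_imp_sums has_sum_infsum)
      moreover have "(\<Sum>k<n. d k y \<bullet> j) = h n y \<bullet> j" for n
        by (induction n) (simp_all add: h0 hSuc' inner_add_left)
      ultimately show ?thesis by (simp add: sums_def)
    qed
    have hlim: "(\<lambda>n. h n y) \<longlonglongrightarrow> \<Psi> y"
    proof -
      have "(\<lambda>n. \<Sum>j\<in>Basis. (h n y \<bullet> j) *\<^sub>R j) \<longlonglongrightarrow> (\<Sum>j\<in>Basis. (\<Psi> y \<bullet> j) *\<^sub>R j)"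
        by (intro tendsto_sum tendsto_scaleR hj tendsto_const)
      then show ?thesis by (simp add: euclidean_representation)
    qed
    have "\<Psi> y \<in> cube \<rho>" unfolding cube_def using majorized_abs_le[OF m\<Psi> y] by auto
    from isCont_tendsto_compose[OF cont[OF this] hlim]
    have "(\<lambda>n. h (Suc n) y) \<longlonglongrightarrow> y - R (\<Psi> y)"
      unfolding hSuc by (intro tendsto_diff tendsto_const)
    then have "\<Psi> y = y - R (\<Psi> y)"
      using LIMSEQ_unique[OF LIMSEQ_Suc[OF hlim]] by blast
    then show ?thesis by (simp add: algebra_simps)
  qed
  have an: "real_analytic_at \<Psi> 0"
    unfolding real_analytic_at_iff_majorizable majorizable_def using m\<Psi> \<sigma>(1) by auto
  have "h n 0 = 0" for n by (induction n) (simp_all add: h0 hSuc R(2))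
  then have \<Psi>0: "\<Psi> 0 = 0" by (simp add: \<Psi>_def d_def)
  have fixed': "\<forall>\<^sub>F y in nhds 0. \<Psi> y + R (\<Psi> y) = y"
    by (rule eventually_mono[OF cube_nhds[OF \<sigma>(1)]]) (rule fixed)
  have l1: "((\<lambda>x. x + R x) \<longlongrightarrow> 0) (nhds 0)"
    using tendsto_add[OF filterlim_ident[of "nhds 0"] tendsto_nhds_real_analytic_at[OF R(1)]] by (simp add: R(2))
  have l2: "((\<lambda>x. \<Psi> (x + R x)) \<longlongrightarrow> 0) (nhds 0)"
    using filterlim_compose[OF tendsto_nhds_real_analytic_at[OF an] l1] by (simp add: \<Psi>0)
  have l3: "((\<lambda>x. (\<Psi> (x + R x), x - \<Psi> (x + R x))) \<longlongrightarrow> 0) (nhds 0)"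
    using tendsto_Pair[OF l2 tendsto_diff[OF filterlim_ident[of "nhds 0"] l2]] by (simp add: zero_prod_def)
  \<comment> \<open>Uniqueness of solutions: \<open>w = \<Psi> (x + R x)\<close> and
    \<open>x\<close> have the same image under the identity plus \<open>R\<close>, so
    \<open>u = x - w\<close> satisfies \<open>u = - (R (w + u) - R w)\<close>, and the sum of its
    absolute coordinates is at most half of itself.\<close>
  have "\<forall>\<^sub>F x in nhds 0. \<Psi> (x + R x) = x"
    using eventually_compose_filterlim[OF cube_nhds[OF \<sigma>(1)] l1]
      eventually_compose_filterlim[OF cube_nhds[OF \<rho>] l3]
  proof eventually_elim
    case (elim x)
    define w where "w = \<Psi> (x + R x)"
    define u where "u = x - w"
    have wu: "(w, u) \<in> cube \<rho>" using elim(2) by (simp add: w_def u_def)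
    have "w + R w = x + R x" using fixed[OF elim(1)] by (simp add: w_def)
    then have u: "u = - (R (w + u) - R w)" by (simp add: u_def algebra_simps)
    have "\<bar>u \<bullet> j\<bar> \<le> \<epsilon> * (\<Sum>i\<in>Basis. \<bar>u \<bullet> i\<bar>)" if j: "j \<in> Basis" for j
    proof -
      have "u \<bullet> j = - (\<Sum>i\<in>Basis. (u \<bullet> i) * q j i (w, u))"
        by (subst u) (simp add: inner_diff_left diff[OF wu j, symmetric])
      then have "\<bar>u \<bullet> j\<bar> \<le> (\<Sum>i\<in>Basis. \<bar>(u \<bullet> i) * q j i (w, u)\<bar>)"
        by (metis abs_minus_cancel sum_abs)
      also have "\<dots> \<le> (\<Sum>i\<in>Basis. \<bar>u \<bullet> i\<bar> * \<epsilon>)"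
        using majorized_abs_le[OF mq wu] j by (intro sum_mono) (auto simp: abs_mult intro!: mult_left_mono)
      finally show ?thesis by (simp add: sum_distrib_left mult.commute)
    qed
    then have "(\<Sum>j\<in>Basis. \<bar>u \<bullet> j\<bar>) \<le> real DIM('a) * (\<epsilon> * (\<Sum>i\<in>Basis. \<bar>u \<bullet> i\<bar>))"
      by (intro sum_bounded_above) auto
    also have "\<dots> = 1 / 2 * (\<Sum>i\<in>Basis. \<bar>u \<bullet> i\<bar>)" using \<epsilon>(2) by (simp add: mult.assoc[symmetric])
    finally have "(\<Sum>j\<in>Basis. \<bar>u \<bullet> j\<bar>) \<le> 0" by simp
    then have "norm u \<le> 0" using norm_le_l1[of u] by linarith
    then show ?case by (simp add: u_def w_def)
  qed
  with an \<Psi>0 fixed' show ?thesis by (rule that)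
qed

text \<open>Applying the inverse \<open>g'\<close> of the differential turns \<open>f\<close>,
  recentred at \<open>a\<close>, into the identity plus a map \<open>R\<close> with vanishing value
  and differential at the origin.\<close>

lemma real_analytic_inverse_function:
  fixes f f' g' :: "'a::euclidean_space \<Rightarrow> 'a"
  assumes f: "real_analytic_at f a" "(f has_derivative f') (at a)"
    and g': "linear g'" "\<And>u. g' (f' u) = u" "\<And>u. f' (g' u) = u"
  obtains g where "real_analytic_at g (f a)" "g (f a) = a"
    "\<forall>\<^sub>F y in nhds (f a). f (g y) = y" "\<forall>\<^sub>F x in nhds a. g (f x) = x"
proof -
  define R where "R x = g' (f (a + x) - f a) - x" for x
  have lin: "real_analytic_at g' x" for x using g'(1) by (rule real_analytic_at_linear)
  have shift: "real_analytic_at (\<lambda>x::'a. c + x) x" for c x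
    by (intro real_analytic_at_add real_analytic_at_const real_analytic_at_linear) (rule linear_id[unfolded id_def])
  have R1: "real_analytic_at R 0"
  proof -
    have "real_analytic_at (\<lambda>x. f (a + x)) 0"
      using real_analytic_at_compose[OF shift, where g=f] f(1) by simp
    then have "real_analytic_at (\<lambda>x. f (a + x) + (- f a)) 0"
      by (intro real_analytic_at_add real_analytic_at_const)
    from real_analytic_at_compose[OF this lin]
    have "real_analytic_at (\<lambda>x. g' (f (a + x) + (- f a))) 0" .
    moreover have "real_analytic_at (\<lambda>x::'a. - x) 0"
      by (intro real_analytic_at_linear linearI) auto
    ultimately have "real_analytic_at (\<lambda>x. g' (f (a + x) + (- f a)) + - x) 0"
      by (rule real_analytic_at_add)
    then show ?thesis by (simp add: R_def[abs_def])
  qed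
  have R2: "R 0 = 0" using g'(1) by (simp add: R_def linear_0)
  have "(R has_derivative (\<lambda>u. g' (f' u - 0) - u)) (at 0)"
    unfolding R_def
  proof (intro has_derivative_diff has_derivative_ident bounded_linear.has_derivative[of g'] has_derivative_const)
    show "bounded_linear g'" using g'(1) by (simp add: linear_conv_bounded_linear)
    show "((\<lambda>x. f (a + x)) has_derivative f') (at 0)"
      using has_derivative_compose[OF has_derivative_add[OF has_derivative_const has_derivative_ident],
          of f f' a 0 UNIV] f(2) by simp
  qed
  then have R3: "(R has_derivative (\<lambda>_. 0)) (at 0)" by (simp add: g'(2))
  obtain \<Psi> where \<Psi>: "real_analytic_at \<Psi> 0" "\<Psi> 0 = 0"
    "\<forall>\<^sub>F y in nhds 0. \<Psi> y + R (\<Psi> y) = y" "\<forall>\<^sub>F x in nhds 0. \<Psi> (x + R x) = x"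
    using real_analytic_near_identity_inverse[OF R1 R2 R3] by blast
  have xR: "x + R x = g' (f (a + x) - f a)" for x by (simp add: R_def)
  define g where "g y = a + \<Psi> (g' (y - f a))" for y
  have lim: "((\<lambda>y. g' (y - f a)) \<longlongrightarrow> 0) (nhds (f a))"
  proof -
    have "((\<lambda>y. y - f a) \<longlongrightarrow> 0) (nhds (f a))"
      using tendsto_diff[OF filterlim_ident tendsto_const, of "f a" "f a"] by simp
    from filterlim_compose[OF tendsto_nhds_real_analytic_at[OF lin] this]
    show ?thesis using g'(1) by (simp add: linear_0)
  qed
  show ?thesis
  proof (rule that[of g])
    show "g (f a) = a" using g'(1) by (simp add: g_def linear_0 \<Psi>(2))
    have 1: "real_analytic_at (\<lambda>y. g' (- f a + y)) (f a)"
      by (rule real_analytic_at_compose[OF shift lin])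
    have "real_analytic_at (\<lambda>y. \<Psi> (g' (- f a + y))) (f a)"
      by (rule real_analytic_at_compose[OF 1]) (use \<Psi>(1) g'(1) in \<open>simp add: linear_0\<close>)
    from real_analytic_at_compose[OF this shift, of a]
    show "real_analytic_at g (f a)" by (simp add: g_def[abs_def])
    show "\<forall>\<^sub>F y in nhds (f a). f (g y) = y"
      using eventually_compose_filterlim[OF \<Psi>(3) lim]
    proof eventually_elim
      case (elim y)
      \<comment> \<open>The equation for \<open>\<Psi>\<close> holds only after applying
        \<open>g'\<close>; applying \<open>f'\<close> removes it.\<close>
      then have "f' (g' (f (g y) - f a)) = f' (g' (y - f a))" by (simp add: xR g_def)
      then show ?case by (simp add: g'(3))
    qed
    have "((\<lambda>x. x - a) \<longlongrightarrow> 0) (nhds a)"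
      using tendsto_diff[OF filterlim_ident tendsto_const, of a a] by simp
    from eventually_compose_filterlim[OF \<Psi>(4) this]
    show "\<forall>\<^sub>F x in nhds a. g (f x) = x"
      by eventually_elim (simp add: xR g_def)
  qed
qed

text \<open>Passes from germs to actual open sets. The target is a ball: it is convex, as the
  identity theorem requires, and when centred on a hyperplane it is preserved by the projection onto
  it.\<close>

lemma real_analytic_local_homeomorphism:
  fixes f f' g' :: "'a::euclidean_space \<Rightarrow> 'a"
  assumes f: "real_analytic_at f a" "(f has_derivative f') (at a)"
    and g': "linear g'" "\<And>u. g' (f' u) = u" "\<And>u. f' (g' u) = u"
    and W: "open W" "a \<in> W"
  obtains e U g where "0 < e" "open U" "a \<in> U" "U \<subseteq> W" "homeomorphism U (ball (f a) e) f g"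
    "\<And>x. x \<in> U \<Longrightarrow> real_analytic_at f x" "\<And>y. y \<in> ball (f a) e \<Longrightarrow> real_analytic_at g y"
proof -
  obtain g where g: "real_analytic_at g (f a)" "g (f a) = a"
    "\<forall>\<^sub>F y in nhds (f a). f (g y) = y" "\<forall>\<^sub>F x in nhds a. g (f x) = x"
    using real_analytic_inverse_function[OF f g'] by blast
  have "\<forall>\<^sub>F x in nhds a. g (f x) = x \<and> real_analytic_at f x \<and> x \<in> W"
    using g(4) real_analytic_at_nearby[OF f(1)] eventually_nhds_in_open[OF W]
    by eventually_elim auto
  then obtain U0 where U0: "open U0" "a \<in> U0"
    "\<And>x. x \<in> U0 \<Longrightarrow> g (f x) = x \<and> real_analytic_at f x \<and> x \<in> W"
    unfolding eventually_nhds by blast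
  have "\<forall>\<^sub>F y in nhds (f a). g y \<in> U0"
    using tendsto_nhds_real_analytic_at[OF g(1)] U0 g(2) by (auto simp: tendsto_def)
  with g(3) real_analytic_at_nearby[OF g(1)]
  have "\<forall>\<^sub>F y in nhds (f a). f (g y) = y \<and> real_analytic_at g y \<and> g y \<in> U0"
    by eventually_elim auto
  then obtain e where e: "0 < e"
    "\<And>y. y \<in> ball (f a) e \<Longrightarrow> f (g y) = y \<and> real_analytic_at g y \<and> g y \<in> U0"
    unfolding eventually_nhds_metric by (auto simp: dist_commute)
  define U where "U = U0 \<inter> f -` ball (f a) e"
  have contf: "continuous_on U0 f" and contg: "continuous_on (ball (f a) e) g"
    using U0(3) e(2) isCont_real_analytic_at by (blast intro: continuous_at_imp_continuous_on)+
  show ?thesis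
  proof (rule that[of e U g])
    show "open U" unfolding U_def
      using continuous_open_preimage[OF contf U0(1), of "ball (f a) e"] by simp
    show "homeomorphism U (ball (f a) e) f g"
    proof (rule homeomorphismI)
      show "continuous_on U f" using contf by (rule continuous_on_subset) (auto simp: U_def)
      show "g ` ball (f a) e \<subseteq> U" using e(2) by (auto simp: U_def)
    qed (use U0 e contg in \<open>auto simp: U_def\<close>)
  qed (use U0 e in \<open>auto simp: U_def\<close>)
qed

section \<open>The identity theorem\<close>

text \<open>On the line an exponent is a single number, so the expansion is an ordinary power
  series, whose centre is not a limit of zeros unless all coefficients vanish.\<close>

lemma real_analytic_zeros_accumulate:
  fixes f :: "real \<Rightarrow> real"
  assumes f: "real_analytic_at f t" and freq: "\<exists>\<^sub>F x in at t. f x = 0"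
  shows "\<forall>\<^sub>F x in nhds t. f x = 0"
proof -
  obtain s N where s: "0 < s" "majorized s N (\<lambda>x. f (t + x))"
    using f by (auto simp: real_analytic_at_real majorizable_def)
  then obtain C where C: "\<And>x. x \<in> cube s \<Longrightarrow> ((\<lambda>\<alpha>. C \<alpha> * monomial x \<alpha>) has_sum f (t + x)) multi_indices"
    by (auto simp: majorized_def)
  define c where "c n = C (\<lambda>i\<in>{1}. n)" for n :: nat
  have bij: "bij_betw (\<lambda>n. \<lambda>i\<in>{1::real}. n) UNIV (multi_indices :: (real \<Rightarrow> nat) set)"
    by (rule bij_betwI[where g="\<lambda>\<alpha>. \<alpha> 1"]) (auto simp: fun_eq_iff PiE_def extensional_def)
  have ps: "(\<lambda>n. c n * (x - t) ^ n) sums f x" if "norm (x - t) < s" for x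
  proof -
    have "x - t \<in> cube s" using that by (auto simp: cube_def)
    from C[OF this] have "((\<lambda>n. C (\<lambda>i\<in>{1}. n) * monomial (x - t) (\<lambda>i\<in>{1}. n)) has_sum f x) UNIV"
      using has_sum_reindex_bij_betw[OF bij, of "\<lambda>\<alpha>. C \<alpha> * monomial (x - t) \<alpha>" "f x"] by simp
    then show ?thesis by (intro has_sum_imp_sums) (simp add: c_def monomial_def)
  qed
  have t0: "f t = 0"
  proof (rule ccontr)
    assume "f t \<noteq> 0"
    then have "\<forall>\<^sub>F x in at t. f x \<noteq> 0"
      using isCont_real_analytic_at[OF f] by (simp add: isCont_def tendsto_imp_eventually_ne)
    with freq show False by (simp add: frequently_def)
  qed
  have "c n = 0" for n
  proof (rule ccontr)
    assume n: "c n \<noteq> 0"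
    have "c 0 = 0" using ps[of t] s(1) t0 by simp
    with n have "0 < n" by (cases n) auto
    obtain r where r: "0 < r" "\<And>z. z \<in> cball t r - {t} \<Longrightarrow> f z \<noteq> 0"
      using powser_0_nonzero[OF s(1) ps t0 n \<open>0 < n\<close>] by blast
    then have "\<forall>\<^sub>F x in at t. f x \<noteq> 0"
      unfolding eventually_at by (intro exI[of _ r]) (auto simp: dist_commute)
    with freq show False by (simp add: frequently_def)
  qed
  then have "f x = 0" if "x \<in> ball t s" for x
    using ps[of x] that by (auto simp: dist_real_def abs_minus_commute sums_iff)
  then show ?thesis
    using s(1) by (auto simp: eventually_nhds intro!: exI[of _ "ball t s"])
qed

text \<open>Restricts to the segment from \<open>q\<close> to \<open>z\<close>: the parameters near
  which \<open>f\<close> vanishes along the line form an open set, closed relative to the unit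
  interval because accumulating zeros force local vanishing.\<close>

lemma real_analytic_identity:
  fixes f :: "'a::euclidean_space \<Rightarrow> real"
  assumes S: "convex S" "\<And>x. x \<in> S \<Longrightarrow> real_analytic_at f x"
    and q: "q \<in> S" "\<forall>\<^sub>F x in nhds q. f x = 0" and z: "z \<in> S"
  shows "f z = 0"
proof -
  define l where "l t = q + t *\<^sub>R (z - q)" for t :: real
  have l: "real_analytic_at l t" for t
    unfolding l_def
    by (intro real_analytic_at_add real_analytic_at_const real_analytic_at_linear linearI)
      (auto simp: algebra_simps)
  have lS: "l t \<in> S" if "t \<in> {0..1}" for t
    using convexD_alt[OF S(1) q(1) z, of t] that by (simp add: l_def algebra_simps)
  have an: "real_analytic_at (\<lambda>t. f (l t)) t" if "t \<in> {0..1}" for t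
    using real_analytic_at_compose[OF l S(2)[OF lS[OF that]]] .
  define Z where "Z = {t. \<forall>\<^sub>F x in nhds t. f (l x) = 0}"
  have "open Z"
    unfolding Z_def open_subopen[of "Collect _"] eventually_nhds by blast
  then have "openin (top_of_set {0..1}) ({0..1} \<inter> Z)" by (rule openin_open_Int)
  moreover have "closedin (top_of_set {0..1}) ({0..1} \<inter> Z)"
    unfolding closedin_limpt
  proof (intro conjI allI impI)
    fix t assume t: "t islimpt {0..1} \<inter> Z \<and> t \<in> {0..1}"
    then have "\<exists>\<^sub>F x in at t. x \<in> {0..1} \<inter> Z"
      by (simp add: islimpt_conv_frequently_at)
    then have "\<exists>\<^sub>F x in at t. f (l x) = 0"
      by (rule frequently_elim1) (auto simp: Z_def dest: eventually_nhds_x_imp_x)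
    with real_analytic_zeros_accumulate[OF an] t show "t \<in> {0..1} \<inter> Z"
      by (auto simp: Z_def)
  qed auto
  ultimately have "{0..1} \<inter> Z = {} \<or> {0..1} \<inter> Z = {0..1}"
    using connected_Icc[of 0 "1::real"] unfolding connected_clopen by blast
  moreover have "0 \<in> Z"
    using eventually_compose_filterlim[OF q(2), of l "nhds 0"] tendsto_nhds_real_analytic_at[OF l, of 0]
    by (simp add: Z_def l_def)
  then have "0 \<in> {0..1} \<inter> Z" by simp
  ultimately have "{0..1} \<inter> Z = {0..1}" by blast
  moreover have "1 \<in> {0..1::real}" by simp
  ultimately have "1 \<in> Z" by blast
  then have "f (l 1) = 0" unfolding Z_def by (auto dest: eventually_nhds_x_imp_x)
  then show ?thesis by (simp add: l_def)
qed

section \<open>Analytic maps and changes of charts\<close>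

lemma real_analytic_on_pointwise:
  assumes "\<And>x. x \<in> V \<Longrightarrow> real_analytic_at f x" shows "real_analytic_on V f"
  unfolding real_analytic_on_def using assms zero_less_one by blast

lemma real_analytic_on_subset:
  assumes "real_analytic_on V f" "W \<subseteq> V" shows "real_analytic_on W f"
  unfolding real_analytic_on_def
proof
  fix a assume "a \<in> W"
  then obtain F r where "real_analytic_at F a" "0 < r" "\<forall>x\<in>V \<inter> ball a r. f x = F x"
    using assms unfolding real_analytic_on_def by blast
  then show "\<exists>F. real_analytic_at F a \<and> (\<exists>r>0. \<forall>x\<in>W \<inter> ball a r. f x = F x)"
    using assms(2) by blast
qed

lemma real_analytic_on_cong:
  "(\<And>x. x \<in> V \<Longrightarrow> f x = g x) \<Longrightarrow> real_analytic_on V f \<longleftrightarrow> real_analytic_on V g"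
  unfolding real_analytic_on_def by simp

lemma real_analytic_at_interior:
  fixes f :: "'a::euclidean_space \<Rightarrow> 'b::euclidean_space"
  assumes "real_analytic_on V f" "a \<in> interior V" shows "real_analytic_at f a"
proof -
  obtain F r where F: "real_analytic_at F a" "0 < r" "\<forall>x\<in>V \<inter> ball a r. f x = F x"
    using assms interior_subset unfolding real_analytic_on_def by blast
  have "\<forall>\<^sub>F x in nhds a. x \<in> interior V \<inter> ball a r"
    using assms(2) F(2) by (intro eventually_nhds_in_open) auto
  then have "\<forall>\<^sub>F x in nhds a. F x = f x"
    by eventually_elim (use F(3) interior_subset in fastforce)
  with F(1) show ?thesis by (rule real_analytic_at_cong)
qed

lemma continuous_on_real_analytic_on:
  fixes f :: "'a::euclidean_space \<Rightarrow> 'b::euclidean_space"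
  assumes "real_analytic_on V f" shows "continuous_on V f"
  unfolding continuous_on_eq_continuous_within
proof
  fix a assume a: "a \<in> V"
  then obtain F r where F: "real_analytic_at F a" "0 < r" "\<forall>x\<in>V \<inter> ball a r. f x = F x"
    using assms unfolding real_analytic_on_def by blast
  have "continuous (at a within V) F"
    using isCont_real_analytic_at[OF F(1)] by (rule continuous_at_imp_continuous_at_within)
  then show "continuous (at a within V) f"
    by (rule continuous_transform_within[OF _ F(2) a]) (use F(3) in \<open>auto simp: dist_commute\<close>)
qed

lemma real_analytic_on_compose:
  fixes f :: "'a::euclidean_space \<Rightarrow> 'b::euclidean_space" and g :: "'b \<Rightarrow> 'c::euclidean_space"
  assumes f: "real_analytic_on V f" and g: "real_analytic_on W g" and "f ` V \<subseteq> W"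
  shows "real_analytic_on V (\<lambda>x. g (f x))"
  unfolding real_analytic_on_def
proof
  fix a assume a: "a \<in> V"
  then obtain F r where F: "real_analytic_at F a" "0 < r" "\<forall>x\<in>V \<inter> ball a r. f x = F x"
    using f unfolding real_analytic_on_def by blast
  have "f a \<in> W" using a assms(3) by blast
  then obtain G s where G: "real_analytic_at G (f a)" "0 < s" "\<forall>y\<in>W \<inter> ball (f a) s. g y = G y"
    using g unfolding real_analytic_on_def by blast
  have fa: "f a = F a" using F a by simp
  have "\<forall>\<^sub>F x in nhds a. F x \<in> ball (f a) s"
    using topological_tendstoD[OF tendsto_nhds_real_analytic_at[OF F(1)] open_ball] G(2)
    by (simp add: fa)
  then obtain t where t: "0 < t" "\<And>x. x \<in> ball a t \<Longrightarrow> F x \<in> ball (f a) s"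
    unfolding eventually_nhds_metric by (auto simp: dist_commute)
  have "real_analytic_at (\<lambda>x. G (F x)) a"
    using real_analytic_at_compose[OF F(1)] G(1) fa by simp
  moreover have "\<forall>x\<in>V \<inter> ball a (min r t). g (f x) = G (F x)"
  proof
    fix x assume x: "x \<in> V \<inter> ball a (min r t)"
    then have "f x = F x" "F x \<in> ball (f a) s" using F(3) t(2) by auto
    then show "g (f x) = G (F x)" using G(3) x assms(3) by auto
  qed
  ultimately show "\<exists>F. real_analytic_at F a \<and> (\<exists>r>0. \<forall>x\<in>V \<inter> ball a r. g (f x) = F x)"
    using F(2) t(1) by (intro exI[of _ "\<lambda>x. G (F x)"] conjI exI[of _ "min r t"]) auto
qed

section \<open>Changing coordinates inside a chart\<close>

lemma is_chart_homeomorphism: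
  assumes "is_chart c"
  shows "homeomorphism (cdom c) (cimage c) (cmap c) (inv_into (cdom c) (cmap c))"
proof -
  obtain \<psi> where \<psi>: "homeomorphism (cdom c) (cimage c) (cmap c) \<psi>"
    using assms by (auto simp: is_chart_def)
  then have inj: "inj_on (cmap c) (cdom c)"
    by (intro inj_on_inverseI[of _ \<psi>]) (simp add: homeomorphism_def)
  \<comment> \<open>On the chart image any inverse agrees with the \<open>inv_into\<close> that
    \<open>in_chart\<close> uses.\<close>
  show ?thesis
    by (rule homeomorphism_cong[OF \<psi> refl refl refl])
      (use \<psi> inj in \<open>auto simp: homeomorphism_def\<close>)
qed

lemma in_chart_cmap:
  assumes "is_chart c" "p \<in> cdom c" shows "in_chart c f (cmap c p) = f p"
  using homeomorphism_apply1[OF is_chart_homeomorphism[OF assms(1)] assms(2)]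
  by (simp add: in_chart_def)

lemma continuous_on_real_analytic_function:
  assumes A: "real_analytic_atlas A" and f: "real_analytic_function A f"
  shows "continuous_on UNIV f"
proof -
  have "continuous_on (\<Union>c\<in>A. cdom c) f"
  proof (rule continuous_on_open_UN)
    fix c assume c: "c \<in> A"
    then have ch: "is_chart c" using A by (simp add: real_analytic_atlas_def)
    show "open (cdom c)" using ch by (simp add: is_chart_def)
    have "continuous_on (cimage c) (in_chart c f)"
      using f c by (auto simp: real_analytic_function_def intro: continuous_on_real_analytic_on)
    then have "continuous_on (cdom c) (in_chart c f \<circ> cmap c)"
      using is_chart_homeomorphism[OF ch] by (intro continuous_on_compose) (auto simp: homeomorphism_def)
    then show "continuous_on (cdom c) f"
      by (simp add: in_chart_cmap[OF ch] cong: continuous_on_cong)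
  qed
  then show ?thesis using A by (simp add: real_analytic_atlas_def)
qed

lemma homeomorphism_change_of_coordinates:
  fixes c :: "('m::topological_space, 'e::euclidean_space) chart"
  assumes c: "is_chart c" and U: "U \<subseteq> cimage c" and h: "homeomorphism U V \<Phi> \<Psi>"
  defines "c' \<equiv> ({q \<in> cdom c. cmap c q \<in> U}, \<Phi> \<circ> cmap c)"
  shows "homeomorphism (cdom c') V (cmap c') (inv_into (cdom c) (cmap c) \<circ> \<Psi>)" "cimage c' = V"
proof -
  have "homeomorphism (cdom c') U (cmap c) (inv_into (cdom c) (cmap c))"
    by (rule homeomorphism_of_subsets[OF is_chart_homeomorphism[OF c]]) (use U in \<open>auto simp: c'_def\<close>)
  from homeomorphism_compose[OF this h]
  show "homeomorphism (cdom c') V (cmap c') (inv_into (cdom c) (cmap c) \<circ> \<Psi>)"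
    by (simp add: c'_def)
  then show "cimage c' = V" by (auto simp: homeomorphism_def)
qed

text \<open>Transitions of the new chart factor through those of \<open>c\<close>: to
  \<open>d\<close> as \<open>transition c d\<close> after \<open>\<Psi>\<close>, from
  \<open>d\<close> as \<open>\<Phi>\<close> after \<open>transition d c\<close>. Since
  \<open>V\<close> is open in the model space, the new chart has open image even when
  \<open>c\<close> is a half-space chart.\<close>

lemma change_of_coordinates_in_maximal_atlas:
  fixes A :: "('m::topological_space, 'e::euclidean_space) chart set"
  assumes A: "real_analytic_atlas A" and c: "c \<in> A"
    and U: "open U" "U \<subseteq> cimage c" and V: "open V" and h: "homeomorphism U V \<Phi> \<Psi>"
    and \<Phi>: "real_analytic_on U \<Phi>" and \<Psi>: "real_analytic_on V \<Psi>"
  shows "({q \<in> cdom c. cmap c q \<in> U}, \<Phi> \<circ> cmap c) \<in> maximal_atlas A"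
proof -
  define c' where "c' = ({q \<in> cdom c. cmap c q \<in> U}, \<Phi> \<circ> cmap c)"
  have dom: "q \<in> cdom c' \<longleftrightarrow> q \<in> cdom c \<and> cmap c q \<in> U" for q by (simp add: c'_def)
  have map: "cmap c' q = \<Phi> (cmap c q)" for q by (simp add: c'_def)
  have ch: "is_chart c" using A c by (simp add: real_analytic_atlas_def)
  note hc = is_chart_homeomorphism[OF ch]
  have hc': "homeomorphism (cdom c') V (cmap c') (inv_into (cdom c) (cmap c) \<circ> \<Psi>)" and im: "cimage c' = V"
    using homeomorphism_change_of_coordinates[OF ch U(2) h] unfolding c'_def by blast+
  have "open (cdom c \<inter> cmap c -` U)"
    using continuous_open_preimage[OF homeomorphism_cont1[OF hc] _ U(1)] ch by (simp add: is_chart_def)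
  also have "cdom c \<inter> cmap c -` U = cdom c'" by (auto simp: dom)
  finally have "open (cdom c')" .
  with hc' im V have ch': "is_chart c'" unfolding is_chart_def by auto
  have "compatible_charts c' d" if d: "d \<in> A" for d
    unfolding compatible_charts_def
  proof
    have comp: "real_analytic_on (cmap c ` (cdom c \<inter> cdom d)) (transition c d)"
      "real_analytic_on (cmap d ` (cdom c \<inter> cdom d)) (transition d c)"
      using A c d by (auto simp: real_analytic_atlas_def compatible_charts_def)
    have chd: "is_chart d" using A d by (simp add: real_analytic_atlas_def)
    have \<Psi>\<Phi>: "\<Psi> (cmap c' q) = cmap c q" if "q \<in> cdom c'" for q
      using that homeomorphism_apply1[OF h] by (simp add: dom map)
    let ?V = "cmap c' ` (cdom c' \<inter> cdom d)"
    have "real_analytic_on ?V (\<lambda>y. transition c d (\<Psi> y))"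
    proof (rule real_analytic_on_compose[OF real_analytic_on_subset[OF \<Psi>] comp(1)])
      show "?V \<subseteq> V" using im by blast
      show "\<Psi> ` ?V \<subseteq> cmap c ` (cdom c \<inter> cdom d)" using \<Psi>\<Phi> dom by auto
    qed
    moreover have "transition c d (\<Psi> y) = transition c' d y" if "y \<in> ?V" for y
      using that \<Psi>\<Phi> by (auto simp: in_chart_cmap[OF ch] in_chart_cmap[OF ch'] dom)
    ultimately show "real_analytic_on ?V (transition c' d)"
      by (rule iffD1[OF real_analytic_on_cong, rotated])
    let ?W = "cmap d ` (cdom c' \<inter> cdom d)"
    have tr: "transition d c x \<in> U \<and> transition d c' x = \<Phi> (transition d c x)" if "x \<in> ?W" for x
      using that by (auto simp: in_chart_cmap[OF chd] dom map)
    have "real_analytic_on ?W (\<lambda>x. \<Phi> (transition d c x))"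
    proof (rule real_analytic_on_compose[OF real_analytic_on_subset[OF comp(2)] \<Phi>])
      show "?W \<subseteq> cmap d ` (cdom c \<inter> cdom d)" using dom by auto
      show "transition d c ` ?W \<subseteq> U" using tr by auto
    qed
    then show "real_analytic_on ?W (transition d c')"
      by (rule iffD1[OF real_analytic_on_cong, rotated]) (simp add: tr)
  qed
  with ch' show ?thesis unfolding maximal_atlas_def c'_def[symmetric] by blast
qed

section \<open>The top stratum of the maximum set\<close>

text \<open>Eliminates \<open>\<Omega>\<close>: a chart domain inside \<open>\<Omega>\<close> sees
  the same maxima, and conversely the chart domain itself serves as \<open>\<Omega>\<close>.\<close>

lemma top_stratum_iff:
  "p \<in> top_stratum A f \<longleftrightarrow> p \<in> MAX_set f \<and> (\<exists>c\<in>maximal_atlas A. \<exists>b\<in>Basis. p \<in> cdom c \<and>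
     open (cimage c) \<and> cmap c ` (cdom c \<inter> MAX_set f) = cimage c \<inter> {x. x \<bullet> b = 0})"
proof
  assume "p \<in> top_stratum A f"
  then obtain \<Omega> where p: "p \<in> MAX_set f" "p \<in> \<Omega>" "analytic_hypersurface A \<Omega> (\<Omega> \<inter> MAX_set f)"
    by (auto simp: top_stratum_def)
  then obtain c b where c: "c \<in> maximal_atlas A" "b \<in> Basis" "p \<in> cdom c" "cdom c \<subseteq> \<Omega>" "open (cimage c)"
    "cmap c ` (cdom c \<inter> (\<Omega> \<inter> MAX_set f)) = cimage c \<inter> {x. x \<bullet> b = 0}"
    unfolding analytic_hypersurface_def by blast
  moreover have "cdom c \<inter> (\<Omega> \<inter> MAX_set f) = cdom c \<inter> MAX_set f" using c(4) by blast
  ultimately show "p \<in> MAX_set f \<and> (\<exists>c\<in>maximal_atlas A. \<exists>b\<in>Basis. p \<in> cdom c \<and>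
     open (cimage c) \<and> cmap c ` (cdom c \<inter> MAX_set f) = cimage c \<inter> {x. x \<bullet> b = 0})"
    using p(1) by metis
next
  assume "p \<in> MAX_set f \<and> (\<exists>c\<in>maximal_atlas A. \<exists>b\<in>Basis. p \<in> cdom c \<and>
     open (cimage c) \<and> cmap c ` (cdom c \<inter> MAX_set f) = cimage c \<inter> {x. x \<bullet> b = 0})"
  then obtain c b where p: "p \<in> MAX_set f" "p \<in> cdom c" and c: "c \<in> maximal_atlas A" "b \<in> Basis"
    "open (cimage c)" "cmap c ` (cdom c \<inter> MAX_set f) = cimage c \<inter> {x. x \<bullet> b = 0}"
    by blast
  have "analytic_hypersurface A (cdom c) (cdom c \<inter> MAX_set f)"
    unfolding analytic_hypersurface_def
    using c by (auto intro!: bexI[of _ c] bexI[of _ b] simp flip: Int_assoc)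
  moreover have "open (cdom c)" using c(1) by (simp add: maximal_atlas_def is_chart_def)
  ultimately show "p \<in> top_stratum A f"
    unfolding top_stratum_def using p by blast
qed

text \<open>A flattening chart at one point certifies every maximum in its domain, so there the
  stratum and the maximum set coincide.\<close>

lemma analytic_hypersurface_top_stratum: "analytic_hypersurface A UNIV (top_stratum A f)"
  unfolding analytic_hypersurface_def
proof (intro conjI ballI)
  fix p assume "p \<in> top_stratum A f"
  then obtain c b where c: "c \<in> maximal_atlas A" "b \<in> Basis" "p \<in> cdom c" "open (cimage c)"
    "cmap c ` (cdom c \<inter> MAX_set f) = cimage c \<inter> {x. x \<bullet> b = 0}"
    unfolding top_stratum_iff by blast
  have "q \<in> top_stratum A f" if "q \<in> cdom c" "q \<in> MAX_set f" for q
    unfolding top_stratum_iff by (intro conjI bexI[of _ c] bexI[of _ b]) (use c that in simp_all)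
  then have "cdom c \<inter> top_stratum A f = cdom c \<inter> MAX_set f"
    by (auto simp: top_stratum_def)
  with c show "\<exists>c\<in>maximal_atlas A. \<exists>b\<in>Basis. p \<in> cdom c \<and> cdom c \<subseteq> UNIV \<and> open (cimage c) \<and>
      cmap c ` (cdom c \<inter> top_stratum A f) = cimage c \<inter> {x. x \<bullet> b = 0}"
    by (intro bexI[of _ c] bexI[of _ b]) auto
qed simp

text \<open>At a maximum all first derivatives vanish, so a nonzero second derivative provides a first
  derivative \<open>G\<close> that vanishes at the maxima and has nonzero differential; \<open>G\<close> then replaces a suitable
  coordinate.\<close>

lemma maxima_in_analytic_hyperplane:
  fixes F :: "'e::euclidean_space \<Rightarrow> real"
  assumes W: "open W" "x0 \<in> W" and F: "real_analytic_at F x0"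
    and max: "\<And>x. x \<in> W \<Longrightarrow> F x \<le> m"
    and hess: "frechet_derivative (\<lambda>y. frechet_derivative F (at y) v) (at x0) u \<noteq> 0"
  obtains b :: 'e and e U \<Phi> \<Psi> where "b \<in> Basis" "0 < e" "open U" "x0 \<in> U" "U \<subseteq> W"
    "homeomorphism U (ball (\<Phi> x0) e) \<Phi> \<Psi>" "\<forall>x\<in>U. real_analytic_at \<Phi> x"
    "\<forall>y\<in>ball (\<Phi> x0) e. real_analytic_at \<Psi> y" "\<forall>x\<in>U. F x = m \<longrightarrow> \<Phi> x \<bullet> b = 0"
proof -
  obtain g where g: "\<And>i. i \<in> Basis \<Longrightarrow> real_analytic_at (g i) x0"
    and dF: "\<forall>\<^sub>F x in nhds x0. (F has_derivative (\<lambda>u. \<Sum>i\<in>Basis. (u \<bullet> i) * g i x)) (at x)"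
    using real_analytic_at_derivative[OF F] by blast
  \<comment> \<open>Near \<open>x0\<close> this is the derivative of \<open>F\<close> in direction
    \<open>v\<close>; \<open>hess\<close> says that the differential of \<open>G\<close> does not
    vanish on \<open>u\<close>.\<close>
  define G where "G x = (\<Sum>i\<in>Basis. (v \<bullet> i) * g i x)" for x
  have "majorizable (\<lambda>x. \<Sum>i\<in>Basis. (v \<bullet> i) * g i (x0 + x))"
    using g by (intro majorizable_sum majorizable_mult majorizable_const) (auto simp: real_analytic_at_real)
  then have G: "real_analytic_at G x0" by (simp add: real_analytic_at_real G_def)
  have FG: "\<forall>\<^sub>F x in nhds x0. frechet_derivative F (at x) v = G x"
    using dF by eventually_elim (simp add: frechet_derivative_at[symmetric] G_def)
  obtain \<gamma> where "\<forall>\<^sub>F x in nhds x0. (G has_derivative (\<lambda>u. \<Sum>i\<in>Basis. (u \<bullet> i) * \<gamma> i x)) (at x)"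
    using real_analytic_at_derivative[OF G] by blast
  then have dG: "(G has_derivative (\<lambda>u. \<Sum>i\<in>Basis. (u \<bullet> i) * \<gamma> i x0)) (at x0)"
    by (rule eventually_nhds_x_imp_x)
  define D where "D u = (\<Sum>i\<in>Basis. (u \<bullet> i) * \<gamma> i x0)" for u
  have dG: "(G has_derivative D) (at x0)" using dG by (simp add: D_def[abs_def])
  have linD: "linear D" using dG by (rule has_derivative_linear)
  have "((\<lambda>y. frechet_derivative F (at y) v) has_derivative D) (at x0)"
  proof (rule has_derivative_transform_eventually[OF dG])
    show "\<forall>\<^sub>F x in at x0. G x = frechet_derivative F (at x) v"
      using FG by (auto simp: eventually_at_filter elim: eventually_mono)
    show "G x0 = frechet_derivative F (at x0) v" using eventually_nhds_x_imp_x[OF FG] by simp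
  qed simp
  with hess have "D u \<noteq> 0" by (simp add: frechet_derivative_at[symmetric])
  have "\<exists>b\<in>Basis. D b \<noteq> 0"
  proof (rule ccontr)
    assume "\<not> ?thesis"
    then have "D b = 0" if "b \<in> Basis" for b using that by blast
    then have "\<gamma> b x0 = 0" if "b \<in> Basis" for b
      using that by (simp add: D_def inner_Basis if_distrib[of "\<lambda>c. c * _"] cong: if_cong)
    then have "D u = 0" by (simp add: D_def)
    with \<open>D u \<noteq> 0\<close> show False ..
  qed
  then obtain b where b: "b \<in> Basis" "D b \<noteq> 0" by blast
  \<comment> \<open>A maximum in the open set \<open>W\<close> is a critical point, in particular in
    direction \<open>v\<close>.\<close>
  have Gmax: "\<forall>\<^sub>F x in nhds x0. F x = m \<longrightarrow> G x = 0"
    using dF eventually_nhds_in_open[OF W]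
  proof eventually_elim
    case (elim x)
    show ?case
    proof
      assume "F x = m"
      then have "(\<lambda>u. \<Sum>i\<in>Basis. (u \<bullet> i) * g i x) = (\<lambda>u. 0)"
        using max by (intro differential_zero_maxmin[OF elim(2) W(1) elim(1)]) auto
      from fun_cong[OF this, of v] show "G x = 0" by (simp add: G_def)
    qed
  qed
  with eventually_nhds_in_open[OF W] have "\<forall>\<^sub>F x in nhds x0. x \<in> W \<and> (F x = m \<longrightarrow> G x = 0)"
    by eventually_elim blast
  then obtain W' where W': "open W'" "x0 \<in> W'" "\<And>x. x \<in> W' \<Longrightarrow> x \<in> W \<and> (F x = m \<longrightarrow> G x = 0)"
    unfolding eventually_nhds by blast
  \<comment> \<open>Replaces the \<open>b\<close>-th coordinate by \<open>G\<close>, which is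
    locally invertible because \<open>D b \<noteq> 0\<close>.\<close>
  define \<Phi> where "\<Phi> x = x + (G x - x \<bullet> b) *\<^sub>R b" for x
  have \<Phi>b: "\<Phi> x \<bullet> b = G x" for x using b(1) by (simp add: \<Phi>_def inner_add_left)
  have Db: "D (w + t *\<^sub>R b) = D w + t * D b" and ib: "(w + t *\<^sub>R b) \<bullet> b = w \<bullet> b + t" for w t
    using b(1) by (simp_all add: linear_add[OF linD] linear_scale[OF linD] inner_add_left)
  have "real_analytic_at \<Phi> x0"
  proof (subst real_analytic_at_components, rule ballI)
    fix j :: 'e
    have "real_analytic_at (\<lambda>x. x \<bullet> j + (G x + - (x \<bullet> b)) * (b \<bullet> j)) x0"
      by (intro real_analytic_at_add real_analytic_at_mult real_analytic_at_const G real_analytic_at_linear linearI)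
        (auto simp: inner_add_left)
    then show "real_analytic_at (\<lambda>x. \<Phi> x \<bullet> j) x0" by (simp add: \<Phi>_def inner_add_left)
  qed
  moreover have "(\<Phi> has_derivative (\<lambda>u. u + (D u - u \<bullet> b) *\<^sub>R b)) (at x0)"
    unfolding \<Phi>_def using dG by (auto intro!: derivative_eq_intros)
  \<comment> \<open>The inverse differential: if \<open>w\<close> is the image of \<open>u\<close>,
    then \<open>w \<bullet> b = D u\<close>, and writing \<open>u = w + t *\<^sub>R b\<close> the
    equation \<open>D w + t * D b = w \<bullet> b\<close> determines \<open>t\<close>.\<close>
  moreover have "linear (\<lambda>w. w + ((w \<bullet> b - D w) / D b) *\<^sub>R b)"
    by (rule linearI)
      (use linD in \<open>simp_all add: linear_add linear_scale inner_add_left algebra_simps add_divide_distrib diff_divide_distrib\<close>)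
  moreover have "u + (D u - u \<bullet> b) *\<^sub>R b + (((u + (D u - u \<bullet> b) *\<^sub>R b) \<bullet> b - D (u + (D u - u \<bullet> b) *\<^sub>R b)) / D b) *\<^sub>R b = u" for u
    unfolding Db ib using b(2) by (simp add: scaleR_left_diff_distrib)
  moreover have "w + ((w \<bullet> b - D w) / D b) *\<^sub>R b + (D (w + ((w \<bullet> b - D w) / D b) *\<^sub>R b) - (w + ((w \<bullet> b - D w) / D b) *\<^sub>R b) \<bullet> b) *\<^sub>R b = w" for w
    unfolding Db ib using b(2) by (simp add: scaleR_left_diff_distrib)
  ultimately obtain e U \<Psi> where "0 < e" "open U" "x0 \<in> U" "U \<subseteq> W'"
    "homeomorphism U (ball (\<Phi> x0) e) \<Phi> \<Psi>" "\<And>x. x \<in> U \<Longrightarrow> real_analytic_at \<Phi> x"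
    "\<And>y. y \<in> ball (\<Phi> x0) e \<Longrightarrow> real_analytic_at \<Psi> y"
    using real_analytic_local_homeomorphism[of \<Phi> x0 "\<lambda>u. u + (D u - u \<bullet> b) *\<^sub>R b" "\<lambda>w. w + ((w \<bullet> b - D w) / D b) *\<^sub>R b" W'] W'(1,2)
    by blast
  then show ?thesis
    using W'(3) \<Phi>b b(1) by (intro that[of b e U \<Phi> \<Psi>]) auto
qed

text \<open>True also where neither function is differentiable: \<open>frechet_derivative\<close> is
  a choice among the derivatives at the point, and both functions have the same ones.\<close>

lemma frechet_derivative_cong_open:
  assumes "open X" "x \<in> X" "\<And>y. y \<in> X \<Longrightarrow> f y = g y"
  shows "frechet_derivative f (at x) = frechet_derivative g (at x)"
proof -
  have "(f has_derivative D) (at x) \<longleftrightarrow> (g has_derivative D) (at x)" for D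
    using has_derivative_transform_within_open[OF _ assms(1,2), of f D UNIV g]
      has_derivative_transform_within_open[OF _ assms(1,2), of g D UNIV f] assms(3) by auto
  then show ?thesis by (simp add: frechet_derivative_def)
qed

text \<open>The Christoffel term drops out because the differential vanishes at an interior maximum.\<close>

lemma hessian_at_max:
  assumes W: "x0 \<in> interior (cimage c)" and F: "real_analytic_at (in_chart c f) x0"
    and max: "\<And>x. x \<in> cimage c \<Longrightarrow> in_chart c f x \<le> in_chart c f x0"
  shows "hessian g f c x0 u v =
    frechet_derivative (\<lambda>y. frechet_derivative (in_chart c f) (at y) v) (at x0) u"
proof -
  let ?F = "in_chart c f"
  have within: "(at y within cimage c) = at y" if "y \<in> interior (cimage c)" for y
    using that by (rule at_within_interior)
  obtain D where D: "(?F has_derivative D) (at x0)"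
    using real_analytic_at_derivative[OF F] by (blast dest: eventually_nhds_x_imp_x)
  have "D = (\<lambda>_. 0)"
    by (rule differential_zero_maxmin[OF W open_interior D]) (use max interior_subset in blast)
  then have "frechet_derivative ?F (at x0) = (\<lambda>_. 0)"
    using frechet_derivative_at[OF D] by simp
  \<comment> \<open>\<open>dir_deriv\<close> differentiates within the chart image; on the interior,
    an open neighbourhood of \<open>x0\<close>, this is the ordinary derivative.\<close>
  moreover have "frechet_derivative (\<lambda>y. frechet_derivative ?F (at y within cimage c) v) (at x0) =
      frechet_derivative (\<lambda>y. frechet_derivative ?F (at y) v) (at x0)"
    by (rule frechet_derivative_cong_open[OF open_interior W]) (simp add: within)
  ultimately show ?thesis
    by (simp add: hessian_def dir_deriv_def within[OF W])
qed

section \<open>Hyperplane slices and closedness of the stratum\<close>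

lemma norm_hyperplane_projection_le:
  assumes "b \<in> Basis" shows "norm (w - (w \<bullet> b) *\<^sub>R b) \<le> norm w"
  unfolding norm_le using assms
  by (simp add: inner_diff_left inner_diff_right inner_commute[of b w])

text \<open>Invariance of domain, applied to the transition between the two hyperplanes.\<close>

lemma openin_hyperplane_slice:
  fixes c d :: "('m::topological_space, 'e::euclidean_space) chart"
  assumes c: "is_chart c" "b \<in> Basis" "cmap c ` (cdom c \<inter> X) \<subseteq> {x. x \<bullet> b = 0}"
    and d: "is_chart d" "b' \<in> Basis" "open (cimage d)" "cmap d ` (cdom d \<inter> X) = cimage d \<inter> {x. x \<bullet> b' = 0}"
  shows "openin (top_of_set {x. x \<bullet> b = 0}) (cmap c ` (cdom c \<inter> cdom d \<inter> X))"
proof -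
  let ?T = "cdom c \<inter> cdom d" and ?\<psi> = "inv_into (cdom d) (cmap d)"
  note hc = is_chart_homeomorphism[OF c(1)] and hd = is_chart_homeomorphism[OF d(1)]
  have \<psi>: "?\<psi> (cmap d q) = q" if "q \<in> cdom d" for q
    using homeomorphism_apply1[OF hd that] .
  have "openin (top_of_set (cdom d)) ?T"
    using c(1) openin_open_Int[of "cdom c" "cdom d"] by (simp add: is_chart_def Int_commute)
  from homeomorphism_imp_open_map[OF hd this] have oT: "open (cmap d ` ?T)"
    using d(3) openin_open_eq by blast
  \<comment> \<open>Injectivity of \<open>cmap d\<close> restricts the slice equation from
    \<open>cdom d\<close> to the overlap of the two domains.\<close>
  have S: "cmap d ` (?T \<inter> X) = cmap d ` ?T \<inter> {x. x \<bullet> b' = 0}" (is "?S = _")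
  proof (intro equalityI subsetI)
    fix x assume "x \<in> cmap d ` (?T \<inter> X)" then show "x \<in> cmap d ` ?T \<inter> {x. x \<bullet> b' = 0}"
      using d(4) by blast
  next
    fix x assume "x \<in> cmap d ` ?T \<inter> {x. x \<bullet> b' = 0}"
    then obtain r where r: "x = cmap d r" "r \<in> ?T" "x \<bullet> b' = 0" by blast
    then have "x \<in> cmap d ` (cdom d \<inter> X)" unfolding d(4) by blast
    then obtain r' where "x = cmap d r'" "r' \<in> cdom d \<inter> X" by blast
    then have "r' = r" using r \<psi> by (metis IntD1 IntD2)
    with r \<open>r' \<in> cdom d \<inter> X\<close> show "x \<in> ?S" by blast
  qed
  have ope: "openin (top_of_set {x. x \<bullet> b' = 0}) ?S"
    unfolding S using openin_open_Int[OF oT] by (simp add: Int_commute)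
  \<comment> \<open>The transition maps one slice injectively into the other hyperplane; both
    hyperplanes have dimension one less than the model space, so the image is open there.\<close>
  have "openin (top_of_set {x. x \<bullet> b = 0}) ((cmap c \<circ> ?\<psi>) ` ?S)"
  proof (rule invariance_of_domain_subspaces[OF ope])
    have "b \<noteq> 0" "b' \<noteq> 0" using c(2) d(2) nonzero_Basis by blast+
    then show "dim {x. x \<bullet> b = 0} \<le> dim {x. x \<bullet> b' = 0}"
      using dim_hyperplane[of b] dim_hyperplane[of b'] by (simp add: inner_commute)
    show "continuous_on ?S (cmap c \<circ> ?\<psi>)"
    proof (rule continuous_on_compose)
      show "continuous_on ?S ?\<psi>"
        using homeomorphism_cont2[OF hd] by (rule continuous_on_subset) blast
      show "continuous_on (?\<psi> ` ?S) (cmap c)"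
        using homeomorphism_cont1[OF hc] by (rule continuous_on_subset) (auto simp: \<psi>)
    qed
    show "inj_on (cmap c \<circ> ?\<psi>) ?S"
    proof (rule inj_onI)
      fix x y assume "x \<in> ?S" "y \<in> ?S" and eq: "(cmap c \<circ> ?\<psi>) x = (cmap c \<circ> ?\<psi>) y"
      then obtain q r where "x = cmap d q" "y = cmap d r" "q \<in> ?T" "r \<in> ?T" by blast
      with eq \<psi> homeomorphism_apply1[OF hc] show "x = y" by (metis IntD1 IntD2 comp_apply)
    qed
  qed (use c(3) \<psi> in \<open>auto simp: subspace_hyperplane2\<close>)
  moreover have "(cmap c \<circ> ?\<psi>) ` ?S = cmap c ` (?T \<inter> X)"
    using \<psi> by (force simp: image_image)
  ultimately show ?thesis by simp
qed

lemma in_top_stratum_if_hessian_nonzero: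
  fixes A :: "('m::topological_space, 'e::euclidean_space) chart set"
  assumes A: "real_analytic_atlas A" and f: "real_analytic_function A f"
    and max: "\<And>y. f y \<le> (SUP y. f y)"
    and bd: "MAX_set f \<inter> manifold_boundary A = {}"
    and p: "p \<in> closure (top_stratum A f)" and hess: "\<not> tensor2_vanishes_at A (hessian g f) p"
  shows "p \<in> top_stratum A f"
proof -
  define m where "m = (SUP y. f y)"
  have MAX: "q \<in> MAX_set f \<longleftrightarrow> f q = m" for q by (simp add: MAX_set_def m_def)
  have "closed (MAX_set f)"
    unfolding MAX_set_def using continuous_on_real_analytic_function[OF A f]
    by (intro closed_Collect_eq continuous_on_const)
  moreover have "top_stratum A f \<subseteq> MAX_set f" by (auto simp: top_stratum_def)
  ultimately have pM: "p \<in> MAX_set f" using p closure_minimal by blast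
  obtain c u v where c: "c \<in> A" "p \<in> cdom c" and h: "hessian g f c (cmap c p) u v \<noteq> 0"
    using hess by (auto simp: tensor2_vanishes_at_def)
  define F where "F = in_chart c f"
  define W where "W = interior (cimage c)"
  define x0 where "x0 = cmap c p"
  have ch: "is_chart c" using A c(1) by (simp add: real_analytic_atlas_def)
  have Fc: "F (cmap c q) = f q" if "q \<in> cdom c" for q
    using in_chart_cmap[OF ch that] by (simp add: F_def)
  have Wc: "W \<subseteq> cimage c" "open W" by (simp_all add: W_def interior_subset)
  \<comment> \<open>Maxima avoid the boundary, and a point outside it lies over the interior of the
    image of every chart of \<open>A\<close> around it.\<close>
  have x0: "x0 \<in> W"
    using bd pM c by (auto simp: manifold_boundary_def x0_def W_def)
  have Fan: "real_analytic_at F x" if "x \<in> W" for x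
    using real_analytic_at_interior f c(1) that unfolding real_analytic_function_def F_def W_def by blast
  have Fm: "F x \<le> m" if "x \<in> cimage c" for x
    using that max Fc by (auto simp: m_def)
  have "F x0 = m" using Fc[OF c(2)] pM MAX by (simp add: x0_def)
  have FmW: "F x \<le> m" if "x \<in> W" for x using Fm Wc(1) that by blast
  have nz: "frechet_derivative (\<lambda>y. frechet_derivative F (at y) v) (at x0) u \<noteq> 0"
    using h hessian_at_max[of x0 c f g u v] x0 Fan[OF x0] Fm \<open>F x0 = m\<close>
    by (simp add: F_def W_def x0_def)
  obtain b :: 'e and e U \<Phi> \<Psi> where b: "b \<in> Basis" and e: "0 < e" and U: "open U" "x0 \<in> U" "U \<subseteq> W"
    and hom: "homeomorphism U (ball (\<Phi> x0) e) \<Phi> \<Psi>" and \<Phi>: "\<forall>x\<in>U. real_analytic_at \<Phi> x"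
    and \<Psi>: "\<forall>y\<in>ball (\<Phi> x0) e. real_analytic_at \<Psi> y"
    and slice: "\<forall>x\<in>U. F x = m \<longrightarrow> \<Phi> x \<bullet> b = 0"
    by (rule maxima_in_analytic_hyperplane[OF Wc(2) x0 Fan[OF x0] FmW nz]) (assumption, rule that)
  define V where "V = ball (\<Phi> x0) e"
  define c' where "c' = ({q \<in> cdom c. cmap c q \<in> U}, \<Phi> \<circ> cmap c)"
  have Uc: "U \<subseteq> cimage c" using U(3) Wc(1) by blast
  have c'max: "c' \<in> maximal_atlas A"
    unfolding c'_def
    using \<Phi> \<Psi> by (intro change_of_coordinates_in_maximal_atlas[OF A c(1) U(1) Uc _ hom] real_analytic_on_pointwise) auto
  then have ch': "is_chart c'" by (simp add: maximal_atlas_def)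
  have im': "cimage c' = V"
    using homeomorphism_change_of_coordinates(2)[OF ch Uc hom] by (simp add: c'_def V_def)
  have dom: "q \<in> cdom c' \<longleftrightarrow> q \<in> cdom c \<and> cmap c q \<in> U" and map: "cmap c' q = \<Phi> (cmap c q)" for q
    by (simp_all add: c'_def)
  have pc': "p \<in> cdom c'" using c(2) U(2) by (simp add: dom x0_def)
  have \<Psi>c': "F (\<Psi> (cmap c' q)) = f q" if "q \<in> cdom c'" for q
    using that homeomorphism_apply1[OF hom] Fc by (simp add: dom map)
  have sub: "cmap c' ` (cdom c' \<inter> MAX_set f) \<subseteq> {x. x \<bullet> b = 0}"
    using slice Fc by (auto simp: dom map MAX)
  have "open (cdom c')" using ch' by (simp add: is_chart_def)
  \<comment> \<open>The domain of \<open>c'\<close> is a neighbourhood of \<open>p\<close>, a point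
    of the closure, so it meets the stratum.\<close>
  then obtain q where q: "q \<in> top_stratum A f" "q \<in> cdom c'"
    using p pc' open_Int_closure_eq_empty[of "cdom c'" "top_stratum A f"] by blast
  then obtain d b' where qM: "q \<in> MAX_set f" and d: "d \<in> maximal_atlas A" "b' \<in> Basis" "q \<in> cdom d"
    "open (cimage d)" "cmap d ` (cdom d \<inter> MAX_set f) = cimage d \<inter> {x. x \<bullet> b' = 0}"
    unfolding top_stratum_iff by blast
  have chd: "is_chart d" using d(1) by (simp add: maximal_atlas_def)
  define y1 where "y1 = cmap c' q"
  have y1: "y1 \<in> V" "y1 \<bullet> b = 0" using q(2) qM sub im' by (auto simp: y1_def)
  have "openin (top_of_set {x. x \<bullet> b = 0}) (cmap c' ` (cdom c' \<inter> cdom d \<inter> MAX_set f))"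
    using openin_hyperplane_slice[OF ch' b sub chd d(2,4,5)] .
  moreover have "y1 \<in> cmap c' ` (cdom c' \<inter> cdom d \<inter> MAX_set f)"
    using q(2) qM d(3) by (auto simp: y1_def)
  ultimately obtain \<delta> where \<delta>: "0 < \<delta>" "ball y1 \<delta> \<inter> {x. x \<bullet> b = 0} \<subseteq> cmap c' ` (cdom c' \<inter> cdom d \<inter> MAX_set f)"
    unfolding openin_contains_ball by blast
  \<comment> \<open>Composing with this projection extends the restriction of \<open>f\<close> to
    the slice to a function on the whole ball, constant in direction \<open>b\<close>.\<close>
  define \<pi> where "\<pi> y = y - (y \<bullet> b) *\<^sub>R b" for y
  have \<pi>b: "\<pi> y \<bullet> b = 0" for y using b by (simp add: \<pi>_def inner_diff_left)
  have \<pi>lin: "linear \<pi>" unfolding \<pi>_def by (rule linearI) (auto simp: inner_add_left algebra_simps)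
  have \<pi>dist: "dist (\<pi> y) z \<le> dist y z" if "z \<bullet> b = 0" for y z
  proof -
    have eq: "\<pi> y - z = (y - z) - ((y - z) \<bullet> b) *\<^sub>R b" using that by (simp add: \<pi>_def inner_diff_left)
    show ?thesis unfolding dist_norm eq by (rule norm_hyperplane_projection_le[OF b])
  qed
  \<comment> \<open>The centre of \<open>V\<close> lies on the hyperplane because \<open>p\<close>
    is a maximum, so the projection does not leave \<open>V\<close>.\<close>
  have "\<Phi> x0 \<bullet> b = 0" using slice U(2) \<open>F x0 = m\<close> by blast
  from \<pi>dist[OF this] have \<pi>V: "\<pi> y \<in> V" if "y \<in> V" for y
    using that unfolding V_def mem_ball dist_commute[of "\<Phi> x0"] by (rule le_less_trans)
  define \<phi> where "\<phi> y = F (\<Psi> (\<pi> y)) + - m" for y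
  have \<phi>0: "\<phi> y = 0" if "y \<in> V" for y
  proof (rule real_analytic_identity[of V \<phi> y1])
    show "convex V" by (simp add: V_def)
    show "real_analytic_at \<phi> z" if z: "z \<in> V" for z
    proof -
      have an: "real_analytic_at (\<lambda>y. \<Psi> (\<pi> y)) z"
        by (rule real_analytic_at_compose[OF real_analytic_at_linear[OF \<pi>lin], where g=\<Psi>])
          (use \<Psi> \<pi>V[OF z] in \<open>simp add: V_def\<close>)
      have "\<Psi> (\<pi> z) \<in> W"
        using \<pi>V[OF z] hom U(3) by (auto simp: V_def homeomorphism_def)
      with Fan have "real_analytic_at (\<lambda>y. F (\<Psi> (\<pi> y))) z"
        by (intro real_analytic_at_compose[OF an, where g=F])
      then show ?thesis unfolding \<phi>_def by (intro real_analytic_at_add real_analytic_at_const)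
    qed
    \<comment> \<open>\<open>y1\<close> lies on the hyperplane, so projecting a point of the ball
      around it stays in that ball and lands on the image of a maximum.\<close>
    have "\<phi> y = 0" if y: "y \<in> ball y1 \<delta>" for y
    proof -
      have "\<pi> y \<in> ball y1 \<delta> \<inter> {x. x \<bullet> b = 0}"
        using \<pi>dist[OF y1(2), of y] y \<pi>b by (auto simp: dist_commute)
      then obtain r where "\<pi> y = cmap c' r" "r \<in> cdom c'" "r \<in> MAX_set f" using \<delta>(2) by blast
      then show ?thesis using \<Psi>c' MAX by (simp add: \<phi>_def)
    qed
    then show "\<forall>\<^sub>F y in nhds y1. \<phi> y = 0"
      using \<delta>(1) unfolding eventually_nhds by (intro exI[of _ "ball y1 \<delta>"]) auto
  qed (use y1 that in auto)
  \<comment> \<open>The inclusion missing from \<open>sub\<close>: on the slice the projection is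
    the identity, so vanishing of \<open>\<phi>\<close> says that the point comes from a
    maximum.\<close>
  have "V \<inter> {x. x \<bullet> b = 0} \<subseteq> cmap c' ` (cdom c' \<inter> MAX_set f)"
  proof
    fix y assume y: "y \<in> V \<inter> {x. x \<bullet> b = 0}"
    then obtain r where r: "y = cmap c' r" "r \<in> cdom c'" using im' by blast
    have "f r = F (\<Psi> (\<pi> y))" using y \<Psi>c'[OF r(2)] by (simp add: \<pi>_def r(1))
    also have "\<dots> = m" using \<phi>0[of y] y by (simp add: \<phi>_def)
    finally show "y \<in> cmap c' ` (cdom c' \<inter> MAX_set f)" using r MAX by blast
  qed
  then have "cmap c' ` (cdom c' \<inter> MAX_set f) = cimage c' \<inter> {x. x \<bullet> b = 0}"
    using sub im' by blast
  moreover have "open (cimage c')" by (simp add: im' V_def)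
  ultimately show ?thesis
    unfolding top_stratum_iff using pM c'max b pc' by blast
qed

section \<open>Completeness of closed subsets, and the conclusion\<close>

lemma intrinsic_dist_antimono:
  assumes "S \<subseteq> T" shows "intrinsic_dist A g T p q \<le> intrinsic_dist A g S p q"
  unfolding intrinsic_dist_def
  \<comment> \<open>Curves in \<open>S\<close> are among the curves in \<open>T\<close>; if
    \<open>S\<close> admits no curve, its infimum is infinite.\<close>
  by (rule INF_superset_mono) (use assms in \<open>auto simp: C1_curve_in_def\<close>)

theorem corollary3p4:
  fixes A :: "('m::{t2_space, second_countable_topology}, 'e::euclidean_space) chart set"
    and g :: "('m, 'e) tensor2"
    and f :: "'m \<Rightarrow> real"
    and \<Sigma> :: "'m set"
  assumes "real_analytic_riemannian_manifold A g"
    and "DIM('e) \<ge> 2"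
    and "real_analytic_function A f"
    and "\<exists>x. \<forall>y. f y \<le> f x"
    and "MAX_set f \<inter> manifold_boundary A = {}"
    and "\<Sigma> = top_stratum A f"
    and "\<Sigma> \<noteq> {}"
    and "\<forall>p\<in>closure \<Sigma>. \<not> tensor2_vanishes_at A (hessian g f) p"
  shows "closure \<Sigma> = \<Sigma> \<and>
    analytic_hypersurface A UNIV \<Sigma> \<and>
    (intrinsically_complete A g UNIV \<longrightarrow> intrinsically_complete A g \<Sigma>)"
proof -
  have A: "real_analytic_atlas A"
    using assms(1) by (simp add: real_analytic_riemannian_manifold_def)
  \<comment> \<open>Attainment makes \<open>f\<close> bounded above, so the supremum that defines
    \<open>MAX_set\<close> is a genuine upper bound.\<close>
  have "bdd_above (range f)" using assms(4) by (auto intro: bdd_aboveI2)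
  then have max: "f y \<le> (SUP y. f y)" for y by (intro cSUP_upper) auto
  have "closure \<Sigma> \<subseteq> \<Sigma>"
    using in_top_stratum_if_hessian_nonzero[OF A assms(3) max assms(5)] assms(6,8) by blast
  then have cl: "closure \<Sigma> = \<Sigma>" using closure_subset by blast
  moreover have "analytic_hypersurface A UNIV \<Sigma>"
    unfolding assms(6) by (rule analytic_hypersurface_top_stratum)
  moreover have "intrinsically_complete A g \<Sigma>" if comp: "intrinsically_complete A g UNIV"
    unfolding intrinsically_complete_def
  proof (intro allI impI)
    fix X :: "nat \<Rightarrow> 'm"
    assume X: "range X \<subseteq> \<Sigma> \<and>
      (\<forall>e>0. \<exists>N. \<forall>i\<ge>N. \<forall>j\<ge>N. intrinsic_dist A g \<Sigma> (X i) (X j) < e)"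
    have "\<forall>e>0. \<exists>N. \<forall>i\<ge>N. \<forall>j\<ge>N. intrinsic_dist A g UNIV (X i) (X j) < e"
      using X intrinsic_dist_antimono[of \<Sigma> UNIV A g] by (meson le_less_trans subset_UNIV)
    then obtain p where p: "X \<longlonglongrightarrow> p"
      using comp unfolding intrinsically_complete_def by blast
    have "closed \<Sigma>" using cl closed_closure[of \<Sigma>] by simp
    then have "p \<in> \<Sigma>"
      by (rule Lim_in_closed_set[OF _ _ sequentially_bot p]) (use X in \<open>auto intro!: always_eventually\<close>)
    with p show "\<exists>p\<in>\<Sigma>. X \<longlonglongrightarrow> p" by blast
  qed
  ultimately show ?thesis by blast
qed

end
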